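(* Let $(\Omega,\mathscr F,\mathbb P)=(\mathcal A^{\mathbb N},\mathcal F^{\mathbb N},p^{\mathbb N})$ with $\tau$ the Bernoulli shift, and let $a:\Omega\to(0,\infty)$ be a measurable function such that $a(\omega)=a(\omega_0)$ depends only on the zero coordinate of $\omega=(\omega_i)_{i\ge0}$, and $$\int\log a(\omega)\,d\mathbb P=0,\qquad a(\omega)\ne1\ \text{ for every }\omega\in\Omega,\qquad\int(\log a(\omega))^2\,d\mathbb P<\infty.$$ Consider the skew product $$F_a:\Omega\times I\to\Omega\times I,\qquad F_a(\omega,x)=(\tau(\omega),f_\omega(x)),\quad f_\omega(x)=\frac{a(\omega)x}{1+(a(\omega)-1)x}.$$ Then $F_a$ exhibits historical behavior for $(\mathbb P\times\mathrm{Leb})$-a.e. point. Moreover, $$\mathcal L(\omega,x)=\{\lambda\delta_0+(1-\lambda)\delta_1:\lambda\in[0,1]\}\quad\text{for any }x\in(0,1)\text{ and }\mathbb P\text{-a.e. }\omega\in\Omega.$$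
   Context: $I=[0,1]$ with Lebesgue measure $\mathrm{Leb}$. $\mathcal A$ is an at most countable alphabet with discrete $\sigma$-algebra $\mathcal F$ and $p$ is a probability measure on $\mathcal A$ with full support. $f^0_\omega=\mathrm{id}$ and $f^n_\omega=f_{\tau^{n-1}(\omega)}\circ\dots\circ f_\omega$ for $n\ge1$. Historical behavior for $(\mathbb P\times\mathrm{Leb})$-a.e. point: for $(\mathbb P\times\mathrm{Leb})$-a.e. $(\omega,x)$ there is a continuous $\varphi:I\to\mathbb R$ such that $\lim_{n\to\infty}\frac1n\sum_{j=0}^{n-1}\varphi(f^j_\omega(x))$ does not exist. $\mathcal L(\omega,x)$ is the set of weak$^*$ accumulation points of $\frac1n\sum_{j=0}^{n-1}\delta_{f^j_\omega(x)}$, $n\ge1$. *)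

theory Defs
  imports "HOL-Probability.Probability"
begin

definition bernoulli_measure :: "'a pmf \<Rightarrow> (nat \<Rightarrow> 'a) measure" where
  "bernoulli_measure p = Pi\<^sub>M UNIV (\<lambda>_. measure_pmf p)"

definition shift :: "(nat \<Rightarrow> 'a) \<Rightarrow> nat \<Rightarrow> 'a" where
  "shift \<omega> = (\<lambda>i. \<omega> (Suc i))"

definition skew_product ::
    "((nat \<Rightarrow> 'a) \<Rightarrow> real \<Rightarrow> real) \<Rightarrow> (nat \<Rightarrow> 'a) \<times> real \<Rightarrow> (nat \<Rightarrow> 'a) \<times> real" where
  "skew_product f = (\<lambda>(\<omega>, x). (shift \<omega>, f \<omega> x))"

primrec fibre_iter ::
    "((nat \<Rightarrow> 'a) \<Rightarrow> real \<Rightarrow> real) \<Rightarrow> nat \<Rightarrow> (nat \<Rightarrow> 'a) \<Rightarrow> real \<Rightarrow> real" where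
  "fibre_iter f 0 \<omega> = id"
| "fibre_iter f (Suc n) \<omega> = f ((shift ^^ n) \<omega>) \<circ> fibre_iter f n \<omega>"

lemma skew_product_funpow:
  "(skew_product f ^^ n) (\<omega>, x) = ((shift ^^ n) \<omega>, fibre_iter f n \<omega> x)"
  by (induction n) (simp_all add: skew_product_def)

definition mobius_fibre :: "((nat \<Rightarrow> 'a) \<Rightarrow> real) \<Rightarrow> (nat \<Rightarrow> 'a) \<Rightarrow> real \<Rightarrow> real" where
  "mobius_fibre a \<omega> x = a \<omega> * x / (1 + (a \<omega> - 1) * x)"

lemma mobius_fibre_unit_interval:
  assumes "a \<omega> > 0" and "x \<in> {0..1}"
  shows "1 + (a \<omega> - 1) * x > 0" and "mobius_fibre a \<omega> x \<in> {0..1}"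
proof -
  have eq: "1 + (a \<omega> - 1) * x = (1 - x) + a \<omega> * x"
    by (simp add: algebra_simps)
  show pos: "1 + (a \<omega> - 1) * x > 0"
  proof (cases "x = 0")
    case False
    then have "a \<omega> * x > 0" using assms by simp
    then show ?thesis unfolding eq using assms by auto
  qed simp
  have "a \<omega> * x \<le> 1 + (a \<omega> - 1) * x" "0 \<le> a \<omega> * x"
    unfolding eq using assms by simp_all
  then show "mobius_fibre a \<omega> x \<in> {0..1}"
    using pos by (simp add: mobius_fibre_def)
qed

text \<open>By \<open>skew_product_funpow\<close>, for a skew product over the shift the second component of
  the \<open>j\<close>-th iterate at \<open>(\<omega>, x)\<close> is the fibre orbit point \<open>f\<^sup>j\<^sub>\<omega> (x)\<close>.
  Observables on the unit interval are represented by functions on the reals, of which only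
  the restriction to \<open>{0..1}\<close> matters.\<close>

definition historical_behavior_ae ::
    "((nat \<Rightarrow> 'a) \<times> real) measure \<Rightarrow>
     ((nat \<Rightarrow> 'a) \<times> real \<Rightarrow> (nat \<Rightarrow> 'a) \<times> real) \<Rightarrow> bool" where
  "historical_behavior_ae M F \<longleftrightarrow>
     (AE z in M. \<exists>\<phi>::real \<Rightarrow> real. continuous_on {0..1} \<phi> \<and>
        \<not> convergent (\<lambda>n. (1 / real n) * (\<Sum>j<n. \<phi> (snd ((F ^^ j) z)))))"

definition unit_borel :: "real measure" where
  "unit_borel = restrict_space borel {0..1}"

definition dirac :: "real \<Rightarrow> real measure" where
  "dirac x = return unit_borel x"

definition add_measure :: "'b measure \<Rightarrow> 'b measure \<Rightarrow> 'b measure" where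
  "add_measure M N = measure_of (space M) (sets M) (\<lambda>A. emeasure M A + emeasure N A)"

lemma sets_add_measure [simp]: "sets (add_measure M N) = sets M"
  by (simp add: add_measure_def)

lemma emeasure_add_measure:
  assumes "sets N = sets M" and A: "A \<in> sets M"
  shows "emeasure (add_measure M N) A = emeasure M A + emeasure N A"
proof (rule emeasure_measure_of[OF add_measure_def])
  show "countably_additive (sets (add_measure M N)) (\<lambda>A. emeasure M A + emeasure N A)"
    using assms(1)
    by (auto intro!: countably_additiveI simp: suminf_add[symmetric] suminf_emeasure)
qed (use A sets.space_closed in \<open>auto simp: positive_def\<close>)

text \<open>The empirical measure \<open>1/n \<Sum>\<^bsub>j<n\<^esub> \<delta>\<close> along the fibre orbit of \<open>x\<close>; its value at
  \<open>n = 0\<close> is the zero measure.\<close>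

primrec dirac_sum :: "(nat \<Rightarrow> real) \<Rightarrow> nat \<Rightarrow> real measure" where
  "dirac_sum y 0 = null_measure unit_borel"
| "dirac_sum y (Suc n) = add_measure (dirac_sum y n) (dirac (y n))"

definition empirical_measure ::
    "((nat \<Rightarrow> 'a) \<Rightarrow> real \<Rightarrow> real) \<Rightarrow> (nat \<Rightarrow> 'a) \<Rightarrow> real \<Rightarrow> nat \<Rightarrow> real measure" where
  "empirical_measure f \<omega> x n =
     scale_measure (ennreal (1 / real n)) (dirac_sum (\<lambda>j. fibre_iter f j \<omega> x) n)"

lemma sets_dirac_sum: "sets (dirac_sum y n) = sets unit_borel"
  by (induction n) simp_all

lemma emeasure_empirical_measure:
  assumes A: "A \<in> sets unit_borel"
  shows "emeasure (empirical_measure f \<omega> x n) A =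
           ennreal (1 / real n) * (\<Sum>j<n. indicator A (fibre_iter f j \<omega> x))"
proof -
  have "emeasure (dirac_sum y n) A = (\<Sum>j<n. indicator A (y j))" for y
  proof (induction n)
    case (Suc n)
    have "emeasure (dirac_sum y (Suc n)) A = emeasure (dirac_sum y n) A + emeasure (dirac (y n)) A"
      unfolding dirac_sum.simps
      by (rule emeasure_add_measure) (simp_all add: sets_dirac_sum dirac_def A)
    with Suc show ?case
      by (simp add: dirac_def A)
  qed simp
  then show ?thesis
    by (simp add: empirical_measure_def)
qed

definition unit_prob_measures :: "real measure set" where
  "unit_prob_measures = {\<mu>. sets \<mu> = sets unit_borel \<and> prob_space \<mu>}"

text \<open>The coarsest topology on the Borel probability measures on \<open>{0..1}\<close> that makes
  \<open>\<mu> \<mapsto> \<integral>\<phi> d\<mu>\<close> continuous for every continuous \<open>\<phi>\<close>.\<close>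

definition weak_star_topology :: "real measure topology" where
  "weak_star_topology = topology_generated_by
     {{\<mu> \<in> unit_prob_measures. integral\<^sup>L \<mu> \<phi> \<in> U} | \<phi> U.
        continuous_on {0..1} \<phi> \<and> open (U :: real set)}"

lemma topspace_weak_star_topology: "topspace weak_star_topology = unit_prob_measures"
proof -
  have "unit_prob_measures \<in> {{\<mu> \<in> unit_prob_measures. integral\<^sup>L \<mu> \<phi> \<in> U} | \<phi> U.
        continuous_on {0..1} \<phi> \<and> open (U :: real set)}"
    by (auto intro!: exI[of _ "\<lambda>_. 0"] exI[of _ UNIV])
  then show ?thesis
    unfolding weak_star_topology_def topology_generated_by_topspace by auto
qed

definition accumulation_points :: "'b topology \<Rightarrow> (nat \<Rightarrow> 'b) \<Rightarrow> 'b set" where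
  "accumulation_points T s =
     {m \<in> topspace T. \<forall>U. openin T U \<and> m \<in> U \<longrightarrow> (\<exists>\<^sub>F n in sequentially. s n \<in> U)}"

definition limit_measures ::
    "((nat \<Rightarrow> 'a) \<Rightarrow> real \<Rightarrow> real) \<Rightarrow> (nat \<Rightarrow> 'a) \<Rightarrow> real \<Rightarrow> real measure set" where
  "limit_measures f \<omega> x = accumulation_points weak_star_topology (empirical_measure f \<omega> x)"

lemma empirical_measure_in_unit_prob_measures:
  assumes a: "\<And>\<omega>. a \<omega> > 0" and x: "x \<in> {0..1}" and n: "n \<ge> 1"
  shows "empirical_measure (mobius_fibre a) \<omega> x n \<in> unit_prob_measures"
proof -
  let ?\<mu> = "empirical_measure (mobius_fibre a) \<omega> x n"
  have orbit: "fibre_iter (mobius_fibre a) j \<omega> x \<in> {0..1}" for j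
  proof (induction j)
    case 0
    then show ?case using x by simp
  next
    case (Suc j)
    then show ?case
      using mobius_fibre_unit_interval(2)[where a = a, OF a Suc] by simp
  qed
  have sets: "sets ?\<mu> = sets unit_borel"
    by (simp add: empirical_measure_def sets_dirac_sum)
  have sp: "space ?\<mu> = {0..1}"
    using sets_eq_imp_space_eq[OF sets] by (simp add: unit_borel_def space_restrict_space)
  have "{0..1} \<in> sets unit_borel"
    using sets.top[of ?\<mu>] by (simp add: sp sets)
  then have "emeasure ?\<mu> {0..1} = ennreal (1 / real n) * (\<Sum>j<n. indicator {0..1} (fibre_iter (mobius_fibre a) j \<omega> x))"
    by (rule emeasure_empirical_measure)
  also have "\<dots> = ennreal (1 / real n) * of_nat n"
    using orbit by (simp del: atLeastAtMost_iff)
  also have "\<dots> = 1"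
    using n by (simp add: ennreal_of_nat_eq_real_of_nat flip: ennreal_mult)
  finally have "prob_space ?\<mu>"
    by (intro prob_spaceI) (simp add: sp)
  with sets show ?thesis
    by (simp add: unit_prob_measures_def)
qed

end

theory Submission
  imports Defs
begin

text \<open>
  In the coordinate \<open>y = ln (x / (1 - x))\<close> on \<open>(0, 1)\<close> the fibre map \<open>f\<^sub>\<omega>\<close> is the translation by \<open>ln (a \<omega>)\<close>.
  The orbit of \<open>x\<close> is thus a random walk \<open>y + S n \<omega>\<close> whose steps are independent, centred, of finite and
  positive variance, and the endpoints \<open>0\<close> and \<open>1\<close> correspond to \<open>-\<infinity>\<close> and \<open>+\<infinity>\<close>. Two almost sure properties of
  this walk imply everything.

  First, it spends a proportion of time tending to \<open>0\<close> in every bounded interval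
  (\<open>AE_null_occupation\<close>). Smoothing with a Gaussian and bounding the characteristic function
  gives \<open>prob (\<bar>S n\<bar> \<le> K) = O (n powr (- 1 / 4))\<close>, see \<open>small_ball_decay\<close>. The sum of these probabilities divided by \<open>n\<close>
  converges, and Kronecker's lemma applies. So the orbit is almost always close to \<open>0\<close> or to \<open>1\<close>, and the
  empirical measure is close to \<open>(1 - u n) \<delta>\<^sub>0 + u n \<delta>\<^sub>1\<close>, where \<open>u n\<close> is the proportion of times \<open>j < n\<close> with
  \<open>S j > 0\<close>.

  Secondly, \<open>u n\<close> comes arbitrarily close to \<open>1\<close> and to \<open>0\<close> infinitely often (\<open>AE_mostly_positive\<close>,
  \<open>AE_mostly_negative\<close>). By the central limit theorem the walk is high at time \<open>m\<close> with probability bounded below, and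
  by Chebyshev's inequality it then stays high for most of the times up to \<open>r m\<close>
  (\<open>prob_mostly_high\<close>). So it is high for most of the time, infinitely often, with positive probability, and by
  Kolmogorov's zero-one law with probability one (\<open>AE_upper_occupation_ge\<close>). The negative side follows by symmetry.

  Since \<open>u\<close> changes by at most \<open>1 / (n + 1)\<close> in one step, it accumulates at every point of \<open>[0, 1]\<close>
  (\<open>freq_accumulates_everywhere\<close>). Therefore the accumulation points of the empirical measures form the
  whole segment (\<open>limit_measures_eq_segment\<close>), and already the averages of the identity diverge.
\<close>

section \<open>Characteristic functions and small balls\<close>

text \<open>
  The second order expansion of the characteristic function \<open>\<phi>\<close> is \<open>1 - \<sigma>\<^sup>2 u\<^sup>2 / 2\<close> with an
  error \<open>u\<^sup>2 / 6 \<cdot> r u\<close>, where \<open>r u\<close> tends to \<open>0\<close> with \<open>u\<close> by dominated convergence and is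
  monotone in \<open>\<bar>u\<bar>\<close>. Near the origin the error therefore takes away at most a third of the
  quadratic term. A bound for \<open>\<bar>\<phi>\<bar>\<close> away from \<open>0\<close> cannot be expected, since \<open>\<bar>\<phi>\<bar>\<close> is periodic
  for lattice distributions.
\<close>

lemma (in real_distribution) norm_char_le_gaussian_near_0:
  assumes "integrable M (\<lambda>x. x)" "expectation (\<lambda>x. x) = 0"
    and sq: "integrable M (\<lambda>x. x\<^sup>2)" and var: "variance (\<lambda>x. x) = \<sigma>\<^sup>2" and "\<sigma> > 0"
  obtains h where "h > 0" "\<And>u. \<bar>u\<bar> \<le> h \<Longrightarrow> cmod (char M u) \<le> exp (- (\<sigma>\<^sup>2 * u\<^sup>2 / 3))"
proof -
  define r where "r t = (LINT x|M. min (6 * x\<^sup>2) (\<bar>t\<bar> * \<bar>x\<bar> ^ 3))" for t :: real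
  have int_r: "integrable M (\<lambda>x. min (6 * x\<^sup>2) (\<bar>t\<bar> * \<bar>x\<bar> ^ 3))" for t :: real
    by (rule Bochner_Integration.integrable_bound[where f = "\<lambda>x. 6 * x\<^sup>2"]) (use sq in auto)
  have "(\<lambda>n. min (6 * x\<^sup>2) (\<bar>inverse (real (Suc n))\<bar> * \<bar>x\<bar> ^ 3)) \<longlonglongrightarrow> min (6 * x\<^sup>2) (\<bar>0\<bar> * \<bar>x\<bar> ^ 3)" for x :: real
    by (intro tendsto_intros LIMSEQ_inverse_real_of_nat)
  then have "(\<lambda>n. r (inverse (real (Suc n)))) \<longlonglongrightarrow> (LINT x|M. 0)"
    unfolding r_def using sq
    by (intro integral_dominated_convergence[where w = "\<lambda>x. 6 * x\<^sup>2"]) auto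
  then have "(\<lambda>n. r (inverse (real (Suc n)))) \<longlonglongrightarrow> 0" by simp
  then have "eventually (\<lambda>n. r (inverse (real (Suc n))) < \<sigma>\<^sup>2) sequentially"
    using \<open>\<sigma> > 0\<close> by (intro order_tendstoD) auto
  then obtain n where n: "r (inverse (real (Suc n))) < \<sigma>\<^sup>2"
    by (auto simp: eventually_sequentially)
  (* The second bound makes 1 - u^2 sigma^2 / 2 nonnegative, so that it is its own modulus. *)
  define h where "h = min (inverse (real (Suc n))) (1 / \<sigma>)"
  have "h > 0" using \<open>\<sigma> > 0\<close> by (simp add: h_def)
  moreover have "cmod (char M u) \<le> exp (- (\<sigma>\<^sup>2 * u\<^sup>2 / 3))" if u: "\<bar>u\<bar> \<le> h" for u
  proof -
    have "r u \<le> r (inverse (real (Suc n)))"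
      unfolding r_def using u
      by (intro integral_mono int_r min.mono mult_right_mono) (auto simp: h_def)
    with n have r: "r u \<le> \<sigma>\<^sup>2" by simp
    have "\<bar>u * \<sigma>\<bar> \<le> 1"
      using u \<open>\<sigma> > 0\<close> by (simp add: h_def abs_mult pos_le_divide_eq)
    then have small: "u\<^sup>2 * \<sigma>\<^sup>2 \<le> 1"
      by (metis power_mult_distrib abs_square_le_1)
    have "cmod (char M u - (1 - u\<^sup>2 * \<sigma>\<^sup>2 / 2)) \<le> (u\<^sup>2 / 6) * r u"
      unfolding r_def by (rule char_approx3) (use assms in auto)
    also have "\<dots> \<le> (u\<^sup>2 / 6) * \<sigma>\<^sup>2" using r by (intro mult_left_mono) auto
    finally have "cmod (char M u) \<le> cmod (1 - u\<^sup>2 * \<sigma>\<^sup>2 / 2) + u\<^sup>2 / 6 * \<sigma>\<^sup>2"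
      using norm_triangle_sub[of "char M u" "of_real (1 - u\<^sup>2 * \<sigma>\<^sup>2 / 2)"] by simp
    also have "cmod (1 - u\<^sup>2 * \<sigma>\<^sup>2 / 2) = 1 - u\<^sup>2 * \<sigma>\<^sup>2 / 2"
    proof -
      have "1 - u\<^sup>2 * \<sigma>\<^sup>2 / 2 \<ge> 0" using small by simp
      moreover have "(1 - u\<^sup>2 * \<sigma>\<^sup>2 / 2 :: complex) = of_real (1 - u\<^sup>2 * \<sigma>\<^sup>2 / 2)" by simp
      ultimately show ?thesis by (metis norm_of_real abs_of_nonneg)
    qed
    also have "1 - u\<^sup>2 * \<sigma>\<^sup>2 / 2 + u\<^sup>2 / 6 * \<sigma>\<^sup>2 = 1 + - (\<sigma>\<^sup>2 * u\<^sup>2 / 3)"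
      by (simp add: field_simps)
    also have "\<dots> \<le> exp (- (\<sigma>\<^sup>2 * u\<^sup>2 / 3))" by (rule exp_ge_add_one_self)
    finally show ?thesis .
  qed
  ultimately show ?thesis by (rule that)
qed

text \<open>
  Parseval's identity with a Gaussian: \<open>exp (- (s x)\<^sup>2 / 2)\<close> is the characteristic function of
  the standard normal law at \<open>s x\<close>, and Fubini's theorem exchanges the two laws.
\<close>

lemma (in real_distribution) expectation_gaussian_eq_char:
  "of_real (expectation (\<lambda>x. exp (- ((s * x)\<^sup>2 / 2))))
     = (CLINT t|std_normal_distribution. char M (s * t))"
proof -
  interpret N: real_distribution std_normal_distribution by (rule real_dist_normal_dist)
  interpret P: pair_prob_space M std_normal_distribution ..
  have "of_real (expectation (\<lambda>x. exp (- ((s * x)\<^sup>2 / 2))))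
      = (CLINT x|M. char std_normal_distribution (s * x))"
    by (simp add: char_std_normal_distribution)
  also have "\<dots> = (CLINT x|M. (CLINT t|std_normal_distribution. iexp (s * x * t)))"
    by (simp add: char_def)
  also have "\<dots> = (CLINT t|std_normal_distribution. (CLINT x|M. iexp (s * x * t)))"
    by (rule P.Fubini_integral[symmetric], rule P.integrable_const_bound[where B = 1]) auto
  also have "\<dots> = (CLINT t|std_normal_distribution. char M (s * t))"
    by (simp add: char_def mult_ac)
  finally show ?thesis .
qed

text \<open>
  Up to the factor \<open>1 / sqrt (1 + v\<^sup>2)\<close> the integrand times the normal density is again a normal
  density, with variance \<open>1 / (1 + v\<^sup>2)\<close>.
\<close>

lemma expectation_std_normal_exp_square:
  "(LINT t|std_normal_distribution. exp (- (v\<^sup>2 * t\<^sup>2 / 2))) = 1 / sqrt (1 + v\<^sup>2)"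
proof -
  define w where "w = 1 / sqrt (1 + v\<^sup>2)"
  have pos: "1 + v\<^sup>2 > 0" by (simp add: add_pos_nonneg)
  have w: "w > 0" "w\<^sup>2 = 1 / (1 + v\<^sup>2)" using pos by (auto simp: w_def power_divide)
  have "(LINT t|std_normal_distribution. exp (- (v\<^sup>2 * t\<^sup>2 / 2)))
     = (LINT t|lborel. std_normal_density t * exp (- (v\<^sup>2 * t\<^sup>2 / 2)))"
    by (subst integral_density) (auto simp: normal_density_nonneg)
  also have "\<dots> = (LINT t|lborel. w * normal_density 0 w t)"
  proof (rule Bochner_Integration.integral_cong[OF refl])
    fix t
    have "- t\<^sup>2 / 2 + - (v\<^sup>2 * t\<^sup>2 / 2) = - t\<^sup>2 / (2 * w\<^sup>2)"
      using pos by (simp add: w field_simps)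
    then have "exp (- t\<^sup>2 / 2) * exp (- (v\<^sup>2 * t\<^sup>2 / 2)) = exp (- t\<^sup>2 / (2 * w\<^sup>2))"
      by (metis exp_add)
    moreover have "sqrt (2 * pi * w\<^sup>2) = sqrt (2 * pi) * w" using w(1) by (simp only: real_sqrt_mult real_sqrt_unique[of w "w\<^sup>2"] real_sqrt_abs abs_of_pos)
    ultimately show "std_normal_density t * exp (- (v\<^sup>2 * t\<^sup>2 / 2)) = w * normal_density 0 w t"
      using w by (simp add: normal_density_def)
  qed
  also have "\<dots> = w" using integral_normal_density[OF w(1), of 0] by simp
  finally show ?thesis by (simp add: w_def)
qed

lemma std_normal_tail_bound:
  assumes "R > 0"
  shows "measure std_normal_distribution {t. R < \<bar>t\<bar>} \<le> 1 / R\<^sup>2"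
proof -
  interpret N: real_distribution std_normal_distribution by (rule real_dist_normal_dist)
  have "N.prob {t. R < \<bar>t\<bar>} \<le> N.prob {t \<in> space std_normal_distribution. R \<le> \<bar>t\<bar>}"
    by (rule N.finite_measure_mono) auto
  also have "\<dots> \<le> N.expectation (\<lambda>t. t\<^sup>2) / R\<^sup>2"
    using integrable_std_normal_distribution_moment[of 2] assms
    by (intro N.second_moment_method) auto
  also have "N.expectation (\<lambda>t. t\<^sup>2) = 1"
    using std_normal_distribution_even_moments(1)[of 1] by simp
  finally show ?thesis .
qed

text \<open>
  The indicator of \<open>[- K, K]\<close> is at most \<open>exp ((s K)\<^sup>2 / 2)\<close> times the Gaussian
  \<open>exp (- (s x)\<^sup>2 / 2)\<close>. The scale \<open>s\<close> is left free: it decides how far from the origin the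
  characteristic function is sampled.
\<close>

lemma (in real_distribution) small_ball_le_char:
  assumes "K \<ge> 0"
  shows "prob {x. \<bar>x\<bar> \<le> K}
    \<le> exp ((s * K)\<^sup>2 / 2) * (LINT t|std_normal_distribution. cmod (char M (s * t)))"
proof -
  interpret N: real_distribution std_normal_distribution by (rule real_dist_normal_dist)
  have int: "integrable M (\<lambda>x. exp (- ((s * x)\<^sup>2 / 2)))"
    by (rule integrable_const_bound[where B = 1]) auto
  have "prob {x. \<bar>x\<bar> \<le> K} = expectation (indicator {x. \<bar>x\<bar> \<le> K})" by simp
  also have "\<dots> \<le> expectation (\<lambda>x. exp ((s * K)\<^sup>2 / 2) * exp (- ((s * x)\<^sup>2 / 2)))"
  proof (rule integral_mono)
    show "integrable M (indicator {x. \<bar>x\<bar> \<le> K} :: real \<Rightarrow> real)"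
      by (rule integrable_const_bound[where B = 1]) auto
    show "integrable M (\<lambda>x. exp ((s * K)\<^sup>2 / 2) * exp (- ((s * x)\<^sup>2 / 2)))"
      using int by simp
    show "indicator {x. \<bar>x\<bar> \<le> K} x \<le> exp ((s * K)\<^sup>2 / 2) * exp (- ((s * x)\<^sup>2 / 2))" for x
    proof (cases "\<bar>x\<bar> \<le> K")
      case True
      then have "\<bar>s * x\<bar> \<le> \<bar>s * K\<bar>" by (auto simp: abs_mult intro!: mult_left_mono)
      then have "(s * x)\<^sup>2 \<le> (s * K)\<^sup>2" by (simp only: abs_le_square_iff)
      with True show ?thesis by (simp flip: exp_add)
    qed simp
  qed
  also have "\<dots> = exp ((s * K)\<^sup>2 / 2) * expectation (\<lambda>x. exp (- ((s * x)\<^sup>2 / 2)))" by simp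
  also have "expectation (\<lambda>x. exp (- ((s * x)\<^sup>2 / 2)))
      \<le> cmod (of_real (expectation (\<lambda>x. exp (- ((s * x)\<^sup>2 / 2)))))"
    by (simp only: norm_of_real abs_ge_self)
  also have "\<dots> \<le> (LINT t|std_normal_distribution. cmod (char M (s * t)))"
    unfolding expectation_gaussian_eq_char by (rule integral_norm_bound)
  finally show ?thesis by simp
qed

section \<open>Centred random walks with finite variance\<close>

locale centred_iid_walk = prob_space M for M :: "'b measure" +
  fixes X :: "nat \<Rightarrow> 'b \<Rightarrow> real" and \<sigma> :: real
  assumes indep: "indep_vars (\<lambda>_. borel) X UNIV"
    and same_distr: "\<And>n. distr M borel (X n) = distr M borel (X 0)"
    and mean_0: "\<And>n. expectation (X n) = 0"
    and square_integrable: "\<And>n. integrable M (\<lambda>\<omega>. (X n \<omega>)\<^sup>2)"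
    and second_moment: "\<And>n. expectation (\<lambda>\<omega>. (X n \<omega>)\<^sup>2) = \<sigma>\<^sup>2"
    and sigma_pos: "\<sigma> > 0"
begin

definition S :: "nat \<Rightarrow> 'b \<Rightarrow> real" where
  "S n \<omega> = (\<Sum>i<n. X i \<omega>)"

lemma X_measurable [measurable]: "X n \<in> borel_measurable M"
  using indep by (simp add: indep_vars_def2)

lemma S_measurable [measurable]: "S n \<in> borel_measurable M"
  unfolding S_def by measurable

lemma X_integrable: "integrable M (X n)"
  by (rule square_integrable_imp_integrable[OF _ square_integrable]) simp

text \<open>
  The characteristic function of \<open>S n\<close> is the \<open>n\<close>-th power of that of one step, hence at most
  \<open>exp (- n \<sigma>\<^sup>2 u\<^sup>2 / 3)\<close> for \<open>\<bar>u\<bar> \<le> h\<close>. In the Gaussian average over \<open>u = s t\<close> this part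
  contributes about \<open>1 / (s sqrt n)\<close>, and the part \<open>\<bar>u\<bar> > h\<close> at most \<open>s\<^sup>2 / h\<^sup>2\<close> by Chebyshev's
  inequality. The choice \<open>s = n powr (- 1 / 4)\<close> gives the stated rate. It is not the optimal
  \<open>n powr (- 1 / 2)\<close>, but any negative power of \<open>n\<close> is enough for the summability in
  \<open>AE_null_occupation\<close>.
\<close>

lemma small_ball_decay:
  assumes "K \<ge> 0"
  obtains C where "\<And>n. n \<ge> 1 \<Longrightarrow> prob {\<omega> \<in> space M. \<bar>S n \<omega>\<bar> \<le> K} \<le> C * real n powr (- 1 / 4)"
proof -
  interpret \<mu>: real_distribution "distr M borel (X 0)" by (rule real_distribution_distr) simp
  interpret N: real_distribution std_normal_distribution by (rule real_dist_normal_dist)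
  let ?\<phi> = "char (distr M borel (X 0))"
  obtain h where h: "h > 0" "\<And>u. \<bar>u\<bar> \<le> h \<Longrightarrow> cmod (?\<phi> u) \<le> exp (- (\<sigma>\<^sup>2 * u\<^sup>2 / 3))"
  proof (rule \<mu>.norm_char_le_gaussian_near_0[of \<sigma>])
    show "integrable (distr M borel (X 0)) (\<lambda>x. x)"
      using X_integrable by (simp add: integrable_distr_eq)
    show mean: "\<mu>.expectation (\<lambda>x. x) = 0"
      by (subst integral_distr) (auto simp: mean_0)
    show "integrable (distr M borel (X 0)) (\<lambda>x. x\<^sup>2)"
      using square_integrable by (simp add: integrable_distr_eq)
    show "\<mu>.variance (\<lambda>x. x) = \<sigma>\<^sup>2"
      unfolding mean by (subst integral_distr) (auto simp: second_moment)
  qed (use sigma_pos in auto)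
  define C where "C = exp (K\<^sup>2 / 2) * (sqrt (3 / 2) / \<sigma> + 1 / h\<^sup>2)"
  have "prob {\<omega> \<in> space M. \<bar>S n \<omega>\<bar> \<le> K} \<le> C * real n powr (- 1 / 4)" if "n \<ge> 1" for n
  proof -
    define q where "q = real n powr (1 / 4)"
    (* The average is taken at scale s = 1 / q, and v is chosen with
       v^2 t^2 / 2 = n sigma^2 (s t)^2 / 3. *)
    define v where "v = sqrt (2 / 3) * \<sigma> * q"
    have q: "q \<ge> 1" "q ^ 4 = real n" "real n powr (- 1 / 4) = 1 / q"
      using that by (auto simp: q_def ge_one_powr_ge_zero powr_minus_divide powr_power)
    have "v > 0" using sigma_pos q by (simp add: v_def)
    have v2: "v\<^sup>2 = 2 / 3 * \<sigma>\<^sup>2 * q\<^sup>2" by (simp add: v_def power_mult_distrib)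
    interpret \<nu>: real_distribution "distr M borel (S n)" by (rule real_distribution_distr) simp
    have char_pow: "char (distr M borel (S n)) u = ?\<phi> u ^ n" for u
    proof -
      have "char (distr M borel (\<lambda>\<omega>. \<Sum>i<n. X i \<omega>)) u = (\<Prod>i<n. char (distr M borel (X i)) u)"
        by (rule char_distr_sum) (rule indep_vars_subset[OF indep], simp)
      also have "\<dots> = ?\<phi> u ^ n" by (subst same_distr) simp
      finally show ?thesis by (simp add: S_def[abs_def])
    qed
    have bound: "cmod (char (distr M borel (S n)) (1 / q * t))
        \<le> exp (- (v\<^sup>2 * t\<^sup>2 / 2)) + indicator {t. h * q < \<bar>t\<bar>} t" for t
    proof (cases "\<bar>t\<bar> \<le> h * q")
      case True
      then have "\<bar>1 / q * t\<bar> \<le> h" using q by (simp add: abs_mult pos_divide_le_eq)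
      from h(2)[OF this] have "cmod (?\<phi> (1 / q * t)) ^ n \<le> exp (- (\<sigma>\<^sup>2 * (1 / q * t)\<^sup>2 / 3)) ^ n"
        by (rule power_mono) simp
      also have "\<dots> = exp (- (v\<^sup>2 * t\<^sup>2 / 2))"
        unfolding exp_of_nat_mult[symmetric] q(2)[symmetric] v2 using q(1)
        by (simp add: power_divide power_mult_distrib field_simps flip: power_add)
      finally show ?thesis using True by (simp add: char_pow norm_power)
    next
      case False
      have "cmod (char (distr M borel (S n)) (1 / q * t)) \<le> 1" by (rule \<nu>.cmod_char_le_1)
      with False show ?thesis by (simp add: add_increasing)
    qed
    have "prob {\<omega> \<in> space M. \<bar>S n \<omega>\<bar> \<le> K} = \<nu>.prob {x. \<bar>x\<bar> \<le> K}"
      by (subst measure_distr) (auto intro!: arg_cong[where f = prob])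
    also have "\<dots> \<le> exp ((1 / q * K)\<^sup>2 / 2)
        * N.expectation (\<lambda>t. cmod (char (distr M borel (S n)) (1 / q * t)))"
      by (rule \<nu>.small_ball_le_char) fact
    also have "\<dots> \<le> exp (K\<^sup>2 / 2) * (1 / v + 1 / (h * q)\<^sup>2)"
    proof (rule mult_mono)
      have "\<bar>1 / q * K\<bar> \<le> \<bar>K\<bar>" using q mult_left_mono[of 1 q K] \<open>K \<ge> 0\<close> by (simp add: pos_divide_le_eq)
      then have "(1 / q * K)\<^sup>2 \<le> K\<^sup>2" by (simp only: abs_le_square_iff)
      then show "exp ((1 / q * K)\<^sup>2 / 2) \<le> exp (K\<^sup>2 / 2)" by simp
      have ex: "integrable std_normal_distribution (\<lambda>t. exp (- (v\<^sup>2 * t\<^sup>2 / 2)))"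
        by (rule N.integrable_const_bound[where B = 1]) auto
      have ind: "integrable std_normal_distribution (indicator {t. h * q < \<bar>t\<bar>} :: real \<Rightarrow> real)"
        by (rule N.integrable_const_bound[where B = 1]) auto
      have "N.expectation (\<lambda>t. cmod (char (distr M borel (S n)) (1 / q * t)))
          \<le> N.expectation (\<lambda>t. exp (- (v\<^sup>2 * t\<^sup>2 / 2)) + indicator {t. h * q < \<bar>t\<bar>} t)"
        by (intro integral_mono bound Bochner_Integration.integrable_add ex ind
            N.integrable_const_bound[where B = 1]) (auto intro: \<nu>.cmod_char_le_1)
      also have "\<dots> = 1 / sqrt (1 + v\<^sup>2) + N.prob {t. h * q < \<bar>t\<bar>}"
        using ex ind by (simp add: expectation_std_normal_exp_square)
      also have "1 / sqrt (1 + v\<^sup>2) \<le> 1 / v"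
      proof -
        have "v \<le> sqrt (1 + v\<^sup>2)" by (rule real_le_rsqrt) simp
        then show ?thesis using \<open>v > 0\<close> by (intro divide_left_mono) (auto intro!: mult_pos_pos simp: add_pos_nonneg)
      qed
      also have "N.prob {t. h * q < \<bar>t\<bar>} \<le> 1 / (h * q)\<^sup>2"
        by (rule std_normal_tail_bound) (use h q in auto)
      finally show "N.expectation (\<lambda>t. cmod (char (distr M borel (S n)) (1 / q * t))) \<le> 1 / v + 1 / (h * q)\<^sup>2"
        by simp
    qed (auto intro: integral_nonneg_AE)
    also have "\<dots> \<le> exp (K\<^sup>2 / 2) * ((sqrt (3 / 2) / \<sigma> + 1 / h\<^sup>2) * (1 / q))"
    proof (rule mult_left_mono)
      have "1 / v = sqrt (3 / 2) / \<sigma> * (1 / q)"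
        by (simp add: v_def real_sqrt_divide)
      moreover have "1 / (h * q)\<^sup>2 \<le> 1 / h\<^sup>2 * (1 / q)"
        using q(1) h(1) by (simp add: power_mult_distrib divide_simps power2_eq_square)
      ultimately show "1 / v + 1 / (h * q)\<^sup>2 \<le> (sqrt (3 / 2) / \<sigma> + 1 / h\<^sup>2) * (1 / q)"
        by (simp add: algebra_simps)
    qed simp
    finally show ?thesis by (simp only: C_def q(3) mult.assoc)
  qed
  then show ?thesis by (rule that)
qed

end

section \<open>Time spent near the origin\<close>

definition freq :: "(nat \<Rightarrow> bool) \<Rightarrow> nat \<Rightarrow> real" where
  "freq P n = (\<Sum>j<n. of_bool (P j)) / real n"

text \<open>
  Kronecker's lemma for nonnegative terms: past a fixed index, \<open>b j \<le> n \<cdot> (b j / j)\<close> for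
  \<open>j < n\<close>, so the sum of the \<open>b j\<close> up to \<open>n\<close> is a constant plus \<open>n\<close> times a small tail of the
  series.
\<close>

lemma kronecker_nonneg:
  fixes b :: "nat \<Rightarrow> real"
  assumes nonneg: "\<And>j. b j \<ge> 0" and "summable (\<lambda>j. b j / real j)"
  shows "(\<lambda>n. (\<Sum>j<n. b j) / real n) \<longlonglongrightarrow> 0"
proof (rule LIMSEQ_I)
  fix e :: real assume "e > 0"
  then have "e / 2 > 0" by simp
  then obtain N where N: "\<And>m n. m \<ge> N \<Longrightarrow> norm (\<Sum>j=m..<n. b j / real j) < e / 2"
    using assms(2) unfolding summable_Cauchy by blast
  (* Starting at a positive index avoids the default value b 0 / 0 = 0. *)
  define N' where "N' = Suc N"
  have small: "(\<Sum>j=N'..<n. b j) \<le> real n * (e / 2)" for n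
  proof -
    have "(\<Sum>j=N'..<n. b j) \<le> (\<Sum>j=N'..<n. real n * (b j / real j))"
    proof (rule sum_mono)
      fix j assume j: "j \<in> {N'..<n}"
      then have "b j * real j \<le> b j * real n" by (intro mult_left_mono nonneg) auto
      with j show "b j \<le> real n * (b j / real j)"
        by (simp add: N'_def pos_le_divide_eq mult.commute)
    qed
    also have "\<dots> = real n * (\<Sum>j=N'..<n. b j / real j)" by (simp add: sum_distrib_left)
    also have "\<dots> \<le> real n * (e / 2)"
      using N[of N' n] by (intro mult_left_mono) (auto simp: N'_def)
    finally show ?thesis .
  qed
  obtain n0 :: nat where n0: "real n0 > (\<Sum>j<N'. b j) / (e / 2)" using reals_Archimedean2 by blast
  show "\<exists>n0. \<forall>n\<ge>n0. norm ((\<Sum>j<n. b j) / real n - 0) < e"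
  proof (intro exI allI impI)
    fix n assume n: "n \<ge> max N' (Suc n0)"
    then have "real n > (\<Sum>j<N'. b j) / (e / 2)" using n0 by simp
    then have head: "(\<Sum>j<N'. b j) < real n * (e / 2)"
      using \<open>e > 0\<close> by (simp only: pos_divide_less_eq \<open>e / 2 > 0\<close>)
    have "(\<Sum>j<n. b j) = (\<Sum>j<N'. b j) + (\<Sum>j=N'..<n. b j)"
      using n by (subst sum.atLeastLessThan_concat[of 0 N' n, symmetric, unfolded lessThan_atLeast0[symmetric]]) auto
    with head small[of n] have "(\<Sum>j<n. b j) < real n * e" by (simp add: field_simps)
    then have "(\<Sum>j<n. b j) / real n < e" using n by (simp add: pos_divide_less_eq mult.commute)
    then show "norm ((\<Sum>j<n. b j) / real n - 0) < e" by (simp add: sum_nonneg nonneg)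
  qed
qed

context centred_iid_walk begin

text \<open>
  The polynomial decay of \<open>prob (\<bar>S j\<bar> \<le> K)\<close> makes the expectation of the sum of the indicators
  divided by \<open>j\<close> finite. The random series is then almost surely finite, and Kronecker's lemma
  turns this into frequency zero.
\<close>

lemma AE_null_occupation:
  "AE \<omega> in M. (\<lambda>n. freq (\<lambda>j. \<bar>S j \<omega>\<bar> \<le> K) n) \<longlonglongrightarrow> 0"
proof (cases "K \<ge> 0")
  case True
  obtain C where C: "\<And>n. n \<ge> 1 \<Longrightarrow> prob {\<omega> \<in> space M. \<bar>S n \<omega>\<bar> \<le> K} \<le> C * real n powr (- 1 / 4)"
    using small_ball_decay[OF True] by blast
  define A where "A j = {\<omega> \<in> space M. \<bar>S j \<omega>\<bar> \<le> K}" for j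
  have A [measurable]: "A j \<in> sets M" for j by (simp add: A_def)
  define f where "f j \<omega> = indicator (A j) \<omega> / real j" for j \<omega>
  have [measurable]: "f j \<in> borel_measurable M" for j unfolding f_def[abs_def] by measurable
  have f_nonneg: "f j \<omega> \<ge> 0" for j \<omega> by (simp add: f_def)
  have nn: "(\<integral>\<^sup>+ \<omega>. ennreal (f j \<omega>) \<partial>M) = ennreal (prob (A j) / real j)" for j
  proof -
    have "integrable M (f j)"
      unfolding f_def by (intro integrable_divide integrable_const_bound[where B = 1]) auto
    then have "(\<integral>\<^sup>+ \<omega>. ennreal (f j \<omega>) \<partial>M) = ennreal (expectation (f j))"
      by (rule nn_integral_eq_integral) (simp add: f_nonneg)
    also have "expectation (f j) = prob (A j) / real j" by (simp add: f_def[abs_def])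
    finally show ?thesis .
  qed
  have "summable (\<lambda>j. C * real j powr (- 5 / 4))"
    by (intro summable_mult) (simp add: summable_real_powr_iff)
  then have sum_prob: "summable (\<lambda>j. prob (A j) / real j)"
  proof (rule summable_comparison_test')
    fix j :: nat assume "j \<ge> 1"
    have "prob (A j) / real j \<le> C * real j powr (- 1 / 4) / real j"
      using C[OF \<open>j \<ge> 1\<close>] by (intro divide_right_mono) (auto simp: A_def)
    also have "\<dots> = C * real j powr (- 1 / 4 - 1)"
      using \<open>j \<ge> 1\<close> by (subst powr_diff) simp
    finally show "norm (prob (A j) / real j) \<le> C * real j powr (- 5 / 4)" by simp
  qed
  have "(\<integral>\<^sup>+ \<omega>. (\<Sum>j. ennreal (f j \<omega>)) \<partial>M) = (\<Sum>j. ennreal (prob (A j) / real j))"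
    by (subst nn_integral_suminf) (auto simp: nn)
  also have "\<dots> < \<infinity>"
    by (subst suminf_ennreal2[OF _ sum_prob]) auto
  finally have "AE \<omega> in M. (\<Sum>j. ennreal (f j \<omega>)) \<noteq> \<infinity>"
    by (intro nn_integral_PInf_AE) auto
  then show ?thesis
  proof (rule AE_mp[OF _ AE_I2], intro impI)
    fix \<omega> assume "\<omega> \<in> space M" and "(\<Sum>j. ennreal (f j \<omega>)) \<noteq> \<infinity>"
    then have "summable (\<lambda>j. f j \<omega>)" by (intro summable_suminf_not_top) (auto simp: f_nonneg)
    then have "summable (\<lambda>j. of_bool (\<bar>S j \<omega>\<bar> \<le> K) / real j)"
      using \<open>\<omega> \<in> space M\<close> by (simp add: f_def A_def indicator_def)
    from kronecker_nonneg[OF _ this] show "(\<lambda>n. freq (\<lambda>j. \<bar>S j \<omega>\<bar> \<le> K) n) \<longlonglongrightarrow> 0"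
      by (simp add: freq_def)
  qed
next
  case False
  then have "\<not> \<bar>x\<bar> \<le> K" for x :: real by (simp add: not_le less_le_trans)
  then show ?thesis by (simp add: freq_def)
qed

end

section \<open>Oscillation: the zero-one law and the central limit theorem\<close>

text \<open>
  Kolmogorov's law for predicates: to be a tail event, \<open>Q\<close> has to be measurable for every
  \<open>\<sigma>\<close>-algebra that makes all but the first \<open>m\<close> variables measurable. In this form the premise
  can be checked with the rules for measurable functions.
\<close>

lemma (in prob_space) kolmogorov_0_1_law_vars:
  fixes X :: "nat \<Rightarrow> 'a \<Rightarrow> real"
  assumes indep: "indep_vars (\<lambda>_. borel) X UNIV"
    and tail: "\<And>m N. space N = space M \<Longrightarrow> (\<And>i. i \<ge> m \<Longrightarrow> X i \<in> borel_measurable N)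
                 \<Longrightarrow> {\<omega> \<in> space M. Q \<omega>} \<in> sets N"
  shows "prob {\<omega> \<in> space M. Q \<omega>} = 0 \<or> prob {\<omega> \<in> space M. Q \<omega>} = 1"
proof -
  define A where "A i = sigma_sets (space M) {X i -` B \<inter> space M | B. B \<in> sets borel}" for i
  have sub: "{X i -` B \<inter> space M | B. B \<in> sets borel} \<subseteq> Pow (space M)" for i by auto
  have "{\<omega> \<in> space M. Q \<omega>} \<in> sigma_sets (space M) (\<Union> (A ` {m..}))" for m
  proof -
    let ?N = "sigma (space M) (\<Union> (A ` {m..}))"
    have sub': "\<Union> (A ` {m..}) \<subseteq> Pow (space M)"
      using sigma_sets_into_sp[OF sub] by (auto simp: A_def)
    have "{\<omega> \<in> space M. Q \<omega>} \<in> sets ?N"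
    proof (rule tail[of _ m])
      show "X i \<in> borel_measurable ?N" if "i \<ge> m" for i
      proof (rule measurableI)
        fix B :: "real set" assume "B \<in> sets borel"
        then have "X i -` B \<inter> space M \<in> A i" by (auto simp: A_def)
        then show "X i -` B \<inter> space ?N \<in> sets ?N"
          using that sub' by (auto intro: sigma_sets.Basic)
      qed simp
    qed (rule space_measure_of_conv)
    then show ?thesis using sub' by simp
  qed
  then have "{\<omega> \<in> space M. Q \<omega>} \<in> tail_events A" by (simp add: tail_events_def)
  moreover have "indep_sets A UNIV" using indep by (simp add: indep_vars_def A_def[abs_def])
  moreover have "sigma_algebra (space M) (A i)" for i
    unfolding A_def by (rule sigma_algebra_sigma_sets[OF sub])
  ultimately show ?thesis by (intro kolmogorov_0_1_law)
qed

text \<open>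
  The upper density of the times at which \<open>s\<close> exceeds \<open>K\<close> is at least \<open>\<theta>\<close>, for every level \<open>K\<close>.
  The quantification over all levels makes the property invariant under adding a constant to \<open>s\<close>
  and changing finitely many terms, so for a random walk it is a tail event. Countable
  quantifiers keep it measurable.
\<close>

definition upper_occupation_ge :: "real \<Rightarrow> (nat \<Rightarrow> real) \<Rightarrow> bool" where
  "upper_occupation_ge \<theta> s \<longleftrightarrow>
     (\<forall>K k. \<exists>\<^sub>F n in sequentially. freq (\<lambda>j. real K < s j) n > \<theta> - 1 / real (Suc k))"

lemma freq_le_freq_add:
  assumes "n > 0" and "\<And>j. m \<le> j \<Longrightarrow> P j \<Longrightarrow> Q j"
  shows "freq P n \<le> freq Q n + real m / real n"
proof -
  have "(\<Sum>j<n. of_bool (P j) :: real) \<le> (\<Sum>j<n. of_bool (Q j) + of_bool (j < m))"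
    using assms(2) by (intro sum_mono) (auto simp: not_le)
  also have "\<dots> = (\<Sum>j<n. of_bool (Q j)) + (\<Sum>j<n. of_bool (j < m))" by (rule sum.distrib)
  also have "(\<Sum>j<n. of_bool (j < m) :: real) \<le> (\<Sum>j<m. 1)"
    by (subst sum.mono_neutral_right[of "{..<n}" "{..<n} \<inter> {..<m}"]) (auto intro: order.trans[OF card_mono[of "{..<m}"]])
  finally show ?thesis
    using assms(1) by (simp add: freq_def divide_right_mono flip: add_divide_distrib)
qed

text \<open>
  A shift by \<open>c\<close> is absorbed by passing to the level \<open>K + c\<close>, and the first \<open>m\<close> terms change a
  frequency by at most \<open>m / n\<close>, which is absorbed by halving the tolerance \<open>1 / (k + 1)\<close>.
\<close>

lemma upper_occupation_ge_shift:
  assumes ev: "\<And>j. j \<ge> m \<Longrightarrow> s j = t j + c" and s: "upper_occupation_ge \<theta> s"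
  shows "upper_occupation_ge \<theta> t"
  unfolding upper_occupation_ge_def
proof (intro allI)
  fix K k :: nat
  define K' where "K' = nat \<lceil>real K + c\<rceil>"
  define k' where "k' = 2 * k + 1"
  have K': "real K + c \<le> real K'" unfolding K'_def by linarith
  have k': "1 / real (Suc k') = 1 / real (Suc k) / 2" by (simp add: k'_def field_simps)
  have "(\<lambda>n. real m / real n) \<longlonglongrightarrow> 0" by (rule lim_const_over_n)
  then have "eventually (\<lambda>n. real m / real n < 1 / real (Suc k')) sequentially"
    by (rule order_tendstoD) simp
  then have "eventually (\<lambda>n. real m / real n < 1 / real (Suc k') \<and> n > 0) sequentially"
    by (intro eventually_conj eventually_gt_at_top)
  moreover have "\<exists>\<^sub>F n in sequentially. freq (\<lambda>j. real K' < s j) n > \<theta> - 1 / real (Suc k')"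
    using s by (simp only: upper_occupation_ge_def)
  ultimately have "\<exists>\<^sub>F n in sequentially. freq (\<lambda>j. real K' < s j) n > \<theta> - 1 / real (Suc k')
      \<and> real m / real n < 1 / real (Suc k') \<and> n > 0"
    by (intro frequently_eventually_frequently)
  then show "\<exists>\<^sub>F n in sequentially. freq (\<lambda>j. real K < t j) n > \<theta> - 1 / real (Suc k)"
  proof (rule frequently_elim1, elim conjE)
    fix n :: nat
    assume n: "real m / real n < 1 / real (Suc k')" "n > 0"
      and f: "freq (\<lambda>j. real K' < s j) n > \<theta> - 1 / real (Suc k')"
    have "freq (\<lambda>j. real K' < s j) n \<le> freq (\<lambda>j. real K < t j) n + real m / real n"
      using n(2) K' ev by (intro freq_le_freq_add) force+
    moreover have "u < e / 2 \<Longrightarrow> \<theta> - e / 2 < x \<Longrightarrow> x \<le> z + u \<Longrightarrow> \<theta> - e < z" for u e x z :: real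
      by linarith
    ultimately show "freq (\<lambda>j. real K < t j) n > \<theta> - 1 / real (Suc k)"
      using n(1) f unfolding k' by blast
  qed
qed

lemma upper_occupation_ge_measurable:
  assumes [measurable]: "\<And>j. t j \<in> borel_measurable N"
  shows "{\<omega> \<in> space N. upper_occupation_ge \<theta> (\<lambda>j. t j \<omega>)} \<in> sets N"
  unfolding upper_occupation_ge_def freq_def frequently_sequentially of_bool_def by measurable

text \<open>
  Continuity from above along the decreasing events that \<open>P n\<close> occurs for some \<open>n \<ge> N\<close>.
\<close>

lemma (in prob_space) prob_frequently_ge:
  assumes [measurable]: "\<And>n::nat. {\<omega> \<in> space M. P n \<omega>} \<in> events"
    and ev: "eventually (\<lambda>n. prob {\<omega> \<in> space M. P n \<omega>} \<ge> \<delta>) sequentially"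
  shows "prob {\<omega> \<in> space M. \<exists>\<^sub>F n in sequentially. P n \<omega>} \<ge> \<delta>"
proof -
  define B where "B N = {\<omega> \<in> space M. \<exists>n\<ge>N. P n \<omega>}" for N
  have [measurable]: "B N \<in> events" for N unfolding B_def by measurable
  have "decseq B" by (rule decseq_SucI) (auto simp: B_def dest: Suc_leD)
  then have "(\<lambda>N. prob (B N)) \<longlonglongrightarrow> prob (\<Inter>N. B N)"
    by (intro finite_Lim_measure_decseq) auto
  moreover have "prob (B N) \<ge> \<delta>" for N
  proof -
    obtain n where "n \<ge> N" "prob {\<omega> \<in> space M. P n \<omega>} \<ge> \<delta>"
      using ev unfolding eventually_sequentially by (metis nle_le)
    moreover from this have "prob {\<omega> \<in> space M. P n \<omega>} \<le> prob (B N)"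
      by (intro finite_measure_mono) (auto simp: B_def)
    ultimately show ?thesis by simp
  qed
  ultimately have "\<delta> \<le> prob (\<Inter>N. B N)" by (intro LIMSEQ_le_const) auto
  also have "(\<Inter>N. B N) = {\<omega> \<in> space M. \<exists>\<^sub>F n in sequentially. P n \<omega>}"
    by (auto simp: B_def frequently_sequentially)
  finally show ?thesis .
qed

lemma std_normal_cdf_less_1: "cdf std_normal_distribution x < 1"
proof (rule ccontr)
  interpret N: real_distribution std_normal_distribution by (rule real_dist_normal_dist)
  assume "\<not> cdf std_normal_distribution x < 1"
  then have "N.prob {..x} = 1" using N.prob_le_1[of "{..x}"] unfolding cdf_def by linarith
  then have "AE t in std_normal_distribution. t \<in> {..x}" by (subst N.prob_eq_1[symmetric]) auto
  then have "AE t in lborel. t \<le> x"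
    by (subst (asm) AE_density) (auto simp: normal_density_pos)
  then have "emeasure lborel {t. \<not> t \<le> x} = 0" by (subst (asm) AE_iff_measurable[OF _ refl]) auto
  moreover have "emeasure lborel {x<..x+1} \<le> emeasure lborel {t. \<not> t \<le> x}"
    by (intro emeasure_mono) auto
  ultimately show False by simp
qed

context centred_iid_walk begin

lemma S_split: "m \<le> j \<Longrightarrow> S j \<omega> = S m \<omega> + (\<Sum>i\<in>{m..<j}. X i \<omega>)"
  unfolding S_def lessThan_atLeast0 by (subst sum.atLeastLessThan_concat) auto

text \<open>
  By the central limit theorem the probability converges to that of a half-line under a normal
  law, whose density is positive everywhere. The value of \<open>\<delta>\<close> is half of this limit.
\<close>

lemma clt_upper_tail:
  obtains \<delta> where "\<delta> > 0"
    "eventually (\<lambda>m. prob {\<omega> \<in> space M. S m \<omega> > z * sqrt (real m)} \<ge> \<delta>) sequentially"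
proof -
  interpret N: real_distribution std_normal_distribution by (rule real_dist_normal_dist)
  let ?Z = "\<lambda>n \<omega>. S n \<omega> / sqrt (real n * \<sigma>\<^sup>2)"
  have clt: "weak_conv_m (\<lambda>n. distr M borel (?Z n)) std_normal_distribution"
    unfolding S_def
    by (rule central_limit_theorem_zero_mean[where \<mu> = "distr M borel (X 0)"])
       (auto simp: indep mean_0 sigma_pos square_integrable second_moment intro: same_distr)
  define p where "p = cdf std_normal_distribution (z / \<sigma>)"
  have "p < 1" unfolding p_def by (rule std_normal_cdf_less_1)
  have "N.prob {z / \<sigma>} = 0"
  proof -
    have "emeasure std_normal_distribution {z / \<sigma>} = 0"
      by (subst emeasure_density) (auto simp: nn_integral_0_iff_AE intro!: AE_mp[OF AE_lborel_singleton[of "z / \<sigma>"]])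
    then show ?thesis by (simp add: measure_def)
  qed
  then have "(\<lambda>n. cdf (distr M borel (?Z n)) (z / \<sigma>)) \<longlonglongrightarrow> p"
    using clt by (simp add: weak_conv_m_def weak_conv_def p_def N.isCont_cdf)
  then have "eventually (\<lambda>n. cdf (distr M borel (?Z n)) (z / \<sigma>) < (1 + p) / 2) sequentially"
    using \<open>p < 1\<close> by (intro order_tendstoD) auto
  moreover have "eventually (\<lambda>n::nat. n > 0) sequentially" by (rule eventually_gt_at_top)
  ultimately have "eventually (\<lambda>m. prob {\<omega> \<in> space M. S m \<omega> > z * sqrt (real m)} \<ge> (1 - p) / 2) sequentially"
  proof eventually_elim
    case (elim m)
    have "sqrt (real m * \<sigma>\<^sup>2) = sqrt (real m) * \<sigma>" using sigma_pos by (simp add: real_sqrt_mult)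
    then have iff: "?Z m \<omega> \<le> z / \<sigma> \<longleftrightarrow> \<not> S m \<omega> > z * sqrt (real m)" for \<omega>
      using sigma_pos elim(2) by (simp add: field_simps not_less)
    have "cdf (distr M borel (?Z m)) (z / \<sigma>) = prob {\<omega> \<in> space M. \<not> S m \<omega> > z * sqrt (real m)}"
      unfolding cdf_def by (subst measure_distr) (auto simp flip: iff intro!: arg_cong[where f = prob])
    also have "\<dots> = 1 - prob {\<omega> \<in> space M. S m \<omega> > z * sqrt (real m)}"
      by (rule prob_neg) measurable
    finally show ?case using elim(1) by (simp add: field_simps)
  qed
  then show ?thesis using that[of "(1 - p) / 2"] \<open>p < 1\<close> by simp
qed

lemma increment_second_moment:
  assumes "finite I"
  shows "integrable M (\<lambda>\<omega>. (\<Sum>i\<in>I. X i \<omega>)\<^sup>2) \<and> expectation (\<lambda>\<omega>. (\<Sum>i\<in>I. X i \<omega>)\<^sup>2) = real (card I) * \<sigma>\<^sup>2"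
  using assms
proof (induction I rule: finite_induct)
  case (insert i I)
  let ?R = "\<lambda>\<omega>. \<Sum>i\<in>I. X i \<omega>"
  have ind: "indep_var borel (X i) borel ?R"
    by (rule indep_vars_sum[OF insert.hyps indep_vars_subset[OF indep]]) simp
  have intR: "integrable M ?R" using X_integrable by simp
  have prod: "integrable M (\<lambda>\<omega>. X i \<omega> * ?R \<omega>)" "expectation (\<lambda>\<omega>. X i \<omega> * ?R \<omega>) = 0"
    using indep_var_integrable[OF ind X_integrable intR] indep_var_lebesgue_integral[OF ind X_integrable intR]
    by (simp_all add: mean_0)
  have eq: "(\<Sum>i\<in>insert i I. X i \<omega>)\<^sup>2 = (X i \<omega>)\<^sup>2 + 2 * (X i \<omega> * ?R \<omega>) + (?R \<omega>)\<^sup>2" for \<omega>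
    using insert by (simp add: power2_sum)
  show ?case
    unfolding eq using insert prod square_integrable by (simp add: second_moment distrib_right)
qed simp

lemma increment_tail_bound:
  assumes "finite I" "b > 0"
  shows "prob {\<omega> \<in> space M. (\<Sum>i\<in>I. X i \<omega>) \<le> - b} \<le> real (card I) * \<sigma>\<^sup>2 / b\<^sup>2"
proof -
  have "prob {\<omega> \<in> space M. (\<Sum>i\<in>I. X i \<omega>) \<le> - b} \<le> prob {\<omega> \<in> space M. \<bar>\<Sum>i\<in>I. X i \<omega>\<bar> \<ge> b}"
    by (intro finite_measure_mono) auto
  also have "\<dots> \<le> real (card I) * \<sigma>\<^sup>2 / b\<^sup>2"
    using second_moment_method[of "\<lambda>\<omega>. \<Sum>i\<in>I. X i \<omega>" b] increment_second_moment[OF assms(1)] assms(2) by simp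
  finally show ?thesis .
qed

text \<open>
  At time \<open>m\<close> the walk is above \<open>(1 + y) sqrt m\<close> with probability at least \<open>\<delta>\<close>. Independently of
  this, the increments after time \<open>m\<close> are below \<open>- y sqrt m\<close> at fewer than \<open>m\<close> of the times in
  \<open>{m..<r m}\<close> with probability at least \<open>1 / 2\<close>: each of these times is bad with probability at
  most \<open>1 / (4 r)\<close> by Chebyshev's inequality, so the expected number of bad times is at most
  \<open>m / 4\<close>. On both events the walk is above \<open>sqrt m\<close> except possibly at the first \<open>m\<close> times and
  at fewer than \<open>m\<close> later ones.
\<close>

lemma prob_mostly_high:
  assumes "r \<ge> (1::nat)"
  obtains \<delta> where "\<delta> > 0"
    "eventually (\<lambda>m. prob {\<omega> \<in> space M. freq (\<lambda>j. sqrt (real m) < S j \<omega>) (r * m) \<ge> 1 - 2 / real r} \<ge> \<delta>)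
       sequentially"
proof -
  (* With this y, Chebyshev's bound r m sigma^2 / (y^2 m) is 1 / (4 r). *)
  define y where "y = 2 * real r * \<sigma>"
  have "y > 0" using assms sigma_pos by (simp add: y_def)
  obtain \<delta> where \<delta>: "\<delta> > 0"
    "eventually (\<lambda>m. prob {\<omega> \<in> space M. S m \<omega> > (1 + y) * sqrt (real m)} \<ge> \<delta>) sequentially"
    using clt_upper_tail[of "1 + y"] by blast
  have "eventually (\<lambda>m. prob {\<omega> \<in> space M. freq (\<lambda>j. sqrt (real m) < S j \<omega>) (r * m) \<ge> 1 - 2 / real r} \<ge> \<delta> / 2)
       sequentially"
    using \<delta>(2) eventually_gt_at_top[of 0]
  proof eventually_elim
    case (elim m)
    define T where "T x j = (\<Sum>i\<in>{m..<j}. x i :: real)" for x j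
    define bad where "bad x = (\<Sum>j\<in>{m..<r*m}. of_bool (T x j \<le> - (y * sqrt (real m))) :: real)" for x
    let ?X = "\<lambda>\<omega> i. X i \<omega>"
    have of_bool_eq: "of_bool (T x j \<le> b) = indicator {..b} (T x j)" for x j b by (simp add: indicator_def)
    have [measurable]: "(\<lambda>\<omega>. T (?X \<omega>) j) \<in> borel_measurable M" for j unfolding T_def by measurable
    have bad_meas [measurable]: "(\<lambda>\<omega>. bad (?X \<omega>)) \<in> borel_measurable M"
      unfolding bad_def of_bool_eq by measurable
    have int1: "integrable M (\<lambda>\<omega>. of_bool (T (?X \<omega>) j \<le> - (y * sqrt (real m))) :: real)" for j
      unfolding of_bool_eq by (rule integrable_const_bound[where B = 1]) auto
    then have int: "integrable M (\<lambda>\<omega>. bad (?X \<omega>))" unfolding bad_def by (rule Bochner_Integration.integrable_sum)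
    have "expectation (\<lambda>\<omega>. of_bool (T (?X \<omega>) j \<le> - (y * sqrt (real m)))) \<le> 1 / (4 * real r)"
      if j: "j \<in> {m..<r*m}" for j
    proof -
      have "expectation (\<lambda>\<omega>. of_bool (T (?X \<omega>) j \<le> - (y * sqrt (real m))))
          = expectation (indicator {\<omega> \<in> space M. T (?X \<omega>) j \<le> - (y * sqrt (real m))})"
        by (rule Bochner_Integration.integral_cong) (auto simp: indicator_def)
      also have "\<dots> = prob {\<omega> \<in> space M. T (?X \<omega>) j \<le> - (y * sqrt (real m))}"
        by (simp add: Int_def conj_commute)
      also have "\<dots> \<le> real (card {m..<j}) * \<sigma>\<^sup>2 / (y * sqrt (real m))\<^sup>2"
        unfolding T_def using \<open>y > 0\<close> elim(2) by (intro increment_tail_bound) auto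
      also have "\<dots> \<le> real (r * m) * \<sigma>\<^sup>2 / (y * sqrt (real m))\<^sup>2"
        using j by (intro divide_right_mono mult_right_mono) (auto simp del: of_nat_mult)
      also have "\<dots> = 1 / (4 * real r)"
        using assms elim(2) sigma_pos by (simp add: y_def power_mult_distrib field_simps power2_eq_square)
      finally show ?thesis .
    qed
    then have "expectation (\<lambda>\<omega>. bad (?X \<omega>)) \<le> real (card {m..<r*m}) * (1 / (4 * real r))"
      unfolding bad_def Bochner_Integration.integral_sum[OF int1] by (intro sum_bounded_above) 
    also have "\<dots> \<le> real (r * m) * (1 / (4 * real r))"
      by (intro mult_right_mono of_nat_mono) auto
    also have "\<dots> = real m / 4" using assms by simp
    finally have E_bad: "expectation (\<lambda>\<omega>. bad (?X \<omega>)) \<le> real m / 4" .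
    have "prob {\<omega> \<in> space M. bad (?X \<omega>) \<ge> real m} \<le> expectation (\<lambda>\<omega>. bad (?X \<omega>)) / real m"
      using elim(2) int by (intro integral_Markov_inequality_measure[where A = "{}"]) (auto simp: bad_def sum_nonneg)
    also have "\<dots> \<le> 1 / 2" using E_bad elim(2) by (simp add: pos_divide_le_eq)
    finally have "prob {\<omega> \<in> space M. bad (?X \<omega>) \<ge> real m} \<le> 1 / 2" .
    moreover have "prob {\<omega> \<in> space M. \<not> bad (?X \<omega>) \<ge> real m} = 1 - prob {\<omega> \<in> space M. bad (?X \<omega>) \<ge> real m}"
      by (rule prob_neg) measurable
    ultimately have half: "prob {\<omega> \<in> space M. bad (?X \<omega>) < real m} \<ge> 1 / 2" by (simp add: not_le)
    have "indep_var borel ((\<lambda>x. \<Sum>i<m. x i) \<circ> (\<lambda>\<omega>. restrict (?X \<omega>) {..<m}))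
                    borel (bad \<circ> (\<lambda>\<omega>. restrict (?X \<omega>) {m..}))"
    proof (rule indep_var_compose[OF indep_var_restrict[OF indep]])
      show "(\<lambda>x. \<Sum>i<m. x i) \<in> borel_measurable (\<Pi>\<^sub>M i\<in>{..<m}. borel :: real measure)"
        by measurable
      show "bad \<in> borel_measurable (\<Pi>\<^sub>M i\<in>{m..}. borel :: real measure)"
        unfolding bad_def[abs_def] of_bool_eq T_def by measurable
    qed auto
    also have "(\<lambda>x. \<Sum>i<m. x i) \<circ> (\<lambda>\<omega>. restrict (?X \<omega>) {..<m}) = S m"
      by (auto simp: S_def fun_eq_iff)
    also have "bad \<circ> (\<lambda>\<omega>. restrict (?X \<omega>) {m..}) = (\<lambda>\<omega>. bad (?X \<omega>))"
    proof -
      have "T (restrict (?X \<omega>) {m..}) j = T (?X \<omega>) j" for \<omega> j by (simp add: T_def)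
      then show ?thesis by (simp add: bad_def fun_eq_iff)
    qed
    finally have ind: "indep_var borel (S m) borel (\<lambda>\<omega>. bad (?X \<omega>))" .
    have "\<delta> / 2 = \<delta> * (1 / 2)" by simp
    also have "\<dots> \<le> prob {\<omega> \<in> space M. S m \<omega> > (1 + y) * sqrt (real m)} * prob {\<omega> \<in> space M. bad (?X \<omega>) < real m}"
      using elim(1) half \<delta>(1) by (intro mult_mono) auto
    also have "\<dots> = prob {\<omega> \<in> space M. S m \<omega> > (1 + y) * sqrt (real m) \<and> bad (?X \<omega>) < real m}"
      using indep_varD[OF ind, of "{(1 + y) * sqrt (real m) <..}" "{..<real m}"]
      by (simp add: vimage_def Int_def conj_commute)
    also have "\<dots> \<le> prob {\<omega> \<in> space M. freq (\<lambda>j. sqrt (real m) < S j \<omega>) (r * m) \<ge> 1 - 2 / real r}"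
    proof (rule finite_measure_mono)
      show "{\<omega> \<in> space M. freq (\<lambda>j. sqrt (real m) < S j \<omega>) (r * m) \<ge> 1 - 2 / real r} \<in> events"
        unfolding freq_def of_bool_def by measurable
      show "{\<omega> \<in> space M. S m \<omega> > (1 + y) * sqrt (real m) \<and> bad (?X \<omega>) < real m}
          \<subseteq> {\<omega> \<in> space M. freq (\<lambda>j. sqrt (real m) < S j \<omega>) (r * m) \<ge> 1 - 2 / real r}"
      proof safe
        fix \<omega> assume high: "S m \<omega> > (1 + y) * sqrt (real m)" and few: "bad (?X \<omega>) < real m"
        have rm: "m \<le> r * m" using assms by simp
        have "of_bool (T (?X \<omega>) j \<le> - (y * sqrt (real m))) + of_bool (sqrt (real m) < S j \<omega>) \<ge> (1::real)"
          if "j \<in> {m..<r*m}" for j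
        proof -
          have "S j \<omega> = S m \<omega> + T (?X \<omega>) j"
            using that by (simp add: T_def S_split)
          with high show ?thesis by (auto simp: algebra_simps)
        qed
        then have "(\<Sum>j\<in>{m..<r*m}. 1 :: real) \<le>
            (\<Sum>j\<in>{m..<r*m}. of_bool (T (?X \<omega>) j \<le> - (y * sqrt (real m))) + of_bool (sqrt (real m) < S j \<omega>))"
          by (rule sum_mono)
        also have "\<dots> = bad (?X \<omega>) + (\<Sum>j\<in>{m..<r*m}. of_bool (sqrt (real m) < S j \<omega>))"
          by (simp add: bad_def sum.distrib del: of_bool_eq_1_iff)
        also have "(\<Sum>j\<in>{m..<r*m}. of_bool (sqrt (real m) < S j \<omega>) :: real) \<le> (\<Sum>j<r*m. of_bool (sqrt (real m) < S j \<omega>))"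
          by (intro sum_mono2) auto
        finally have "real (r * m) - real m - real m \<le> (\<Sum>j<r*m. of_bool (sqrt (real m) < S j \<omega>))"
          using few rm by (simp add: of_nat_diff)
        then have "(real (r * m) - real m - real m) / real (r * m) \<le> freq (\<lambda>j. sqrt (real m) < S j \<omega>) (r * m)"
          unfolding freq_def by (rule divide_right_mono) simp
        moreover have "(real (r * m) - real m - real m) / real (r * m) = 1 - 2 / real r"
          using assms elim(2) by (simp add: field_simps)
        ultimately show "1 - 2 / real r \<le> freq (\<lambda>j. sqrt (real m) < S j \<omega>) (r * m)" by simp
      qed
    qed
    finally show ?case .
  qed
  with \<delta>(1) show ?thesis by (intro that[of "\<delta> / 2"]) auto
qed

text \<open>
  The events of \<open>prob_mostly_high\<close> have probability at least \<open>\<delta>\<close>, so infinitely many of them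
  occur with probability at least \<open>\<delta>\<close>. Their levels \<open>sqrt m\<close> grow, hence any level \<open>K\<close> is
  eventually below them and the tail event has positive probability. By the zero-one law its
  probability is \<open>1\<close>. The constant \<open>\<delta>\<close> depends on \<open>r\<close>, which is why the zero-one law is used for
  each \<open>r\<close> separately.
\<close>

lemma AE_upper_occupation_ge:
  assumes "r \<ge> (1::nat)"
  shows "AE \<omega> in M. upper_occupation_ge (1 - 2 / real r) (\<lambda>j. S j \<omega>)"
proof -
  let ?\<theta> = "1 - 2 / real r"
  let ?E = "{\<omega> \<in> space M. upper_occupation_ge ?\<theta> (\<lambda>j. S j \<omega>)}"
  have E: "?E \<in> events" by (rule upper_occupation_ge_measurable) simp
  have "prob ?E = 0 \<or> prob ?E = 1"
  proof (rule kolmogorov_0_1_law_vars[OF indep])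
    fix m and N :: "'b measure"
    assume N: "space N = space M" and XN: "\<And>i. i \<ge> m \<Longrightarrow> X i \<in> borel_measurable N"
    (* The increments after time m differ from the walk by a constant and are measurable for N. *)
    define t where "t j \<omega> = (\<Sum>i\<in>{m..<j}. X i \<omega>)" for j \<omega>
    have S_eq: "S j \<omega> = t j \<omega> + S m \<omega>" if "j \<ge> m" for j \<omega>
      using that by (simp add: t_def S_split)
    have t_eq: "t j \<omega> = S j \<omega> + - S m \<omega>" if "j \<ge> m" for j \<omega>
      using that by (simp add: t_def S_split)
    have "upper_occupation_ge ?\<theta> (\<lambda>j. S j \<omega>) \<longleftrightarrow> upper_occupation_ge ?\<theta> (\<lambda>j. t j \<omega>)" for \<omega>
      using upper_occupation_ge_shift[of m "\<lambda>j. S j \<omega>" "\<lambda>j. t j \<omega>", OF S_eq]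
        upper_occupation_ge_shift[of m "\<lambda>j. t j \<omega>" "\<lambda>j. S j \<omega>", OF t_eq] by blast
    moreover have "t j \<in> borel_measurable N" for j
      unfolding t_def[abs_def] by (intro borel_measurable_sum XN) auto
    from upper_occupation_ge_measurable[of t N, OF this]
    have "{\<omega> \<in> space N. upper_occupation_ge ?\<theta> (\<lambda>j. t j \<omega>)} \<in> sets N" .
    ultimately show "?E \<in> sets N" by (simp add: N)
  qed
  moreover have "prob ?E > 0"
  proof -
    let ?G = "\<lambda>m \<omega>. freq (\<lambda>j. sqrt (real m) < S j \<omega>) (r * m) \<ge> ?\<theta>"
    obtain \<delta> where \<delta>: "\<delta> > 0" "eventually (\<lambda>m. prob {\<omega> \<in> space M. ?G m \<omega>} \<ge> \<delta>) sequentially"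
      using prob_mostly_high[OF assms] by blast
    have "\<delta> \<le> prob {\<omega> \<in> space M. \<exists>\<^sub>F m in sequentially. ?G m \<omega>}"
    proof (rule prob_frequently_ge[OF _ \<delta>(2)])
      show "{\<omega> \<in> space M. ?G m \<omega>} \<in> events" for m
        unfolding freq_def of_bool_def by measurable
    qed
    also have "\<dots> \<le> prob ?E"
    proof (rule finite_measure_mono[OF _ E], safe)
      fix \<omega> assume G: "\<exists>\<^sub>F m in sequentially. ?G m \<omega>"
      show "upper_occupation_ge ?\<theta> (\<lambda>j. S j \<omega>)"
        unfolding upper_occupation_ge_def frequently_sequentially
      proof (intro allI)
        fix K k N :: nat
        from G obtain m where m: "m \<ge> max (Suc N) (K\<^sup>2)" "?G m \<omega>"
          unfolding frequently_sequentially by blast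
        have "real K \<le> sqrt (real m)"
          using m(1) by (intro real_le_rsqrt) (simp flip: of_nat_power)
        then have "freq (\<lambda>j. sqrt (real m) < S j \<omega>) (r * m) \<le> freq (\<lambda>j. real K < S j \<omega>) (r * m) + real 0 / real (r * m)"
          using m(1) assms by (intro freq_le_freq_add) auto
        with m(2) have "freq (\<lambda>j. real K < S j \<omega>) (r * m) \<ge> ?\<theta>" by simp
        moreover have "?\<theta> - 1 / real (Suc k) < ?\<theta>" by simp
        moreover have "N \<le> r * m" using m(1) assms by (metis max.bounded_iff Suc_leD le_trans mult_le_mono1 nat_mult_1)
        ultimately show "\<exists>n\<ge>N. ?\<theta> - 1 / real (Suc k) < freq (\<lambda>j. real K < S j \<omega>) n"
          by (intro exI[of _ "r * m"]) linarith
      qed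
    qed
    finally show ?thesis using \<delta>(1) by simp
  qed
  ultimately have "prob ?E = 1" by linarith
  then have "AE \<omega> in M. \<omega> \<in> ?E" by (subst prob_eq_1[OF E, symmetric])
  then show ?thesis by eventually_elim simp
qed

lemma AE_mostly_positive:
  "AE \<omega> in M. \<forall>\<epsilon>>0. \<exists>\<^sub>F n in sequentially. freq (\<lambda>j. S j \<omega> > 0) n > 1 - \<epsilon>"
proof -
  have "AE \<omega> in M. \<forall>r. upper_occupation_ge (1 - 2 / real (Suc r)) (\<lambda>j. S j \<omega>)"
    unfolding AE_all_countable by (intro allI AE_upper_occupation_ge) simp
  then show ?thesis
  proof eventually_elim
    case (elim \<omega>)
    show ?case
    proof (intro allI impI)
      fix \<epsilon> :: real assume "\<epsilon> > 0"
      obtain r :: nat where "real r > 3 / \<epsilon>" using reals_Archimedean2 by blast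
      (* Index k = r in the definition adds a further loss of 1 / (r + 1) to the 2 / (r + 1). *)
      then have "3 / real (Suc r) < \<epsilon>" using \<open>\<epsilon> > 0\<close> by (simp add: field_simps)
      then have le: "1 - \<epsilon> < 1 - 2 / real (Suc r) - 1 / real (Suc r)"
        using add_divide_distrib[of 2 1 "real (Suc r)"] by linarith
      have "\<exists>\<^sub>F n in sequentially. freq (\<lambda>j. real 0 < S j \<omega>) n > 1 - 2 / real (Suc r) - 1 / real (Suc r)"
        using elim unfolding upper_occupation_ge_def by blast
      then show "\<exists>\<^sub>F n in sequentially. freq (\<lambda>j. S j \<omega> > 0) n > 1 - \<epsilon>"
        by (rule frequently_elim1) (use le in simp)
    qed
  qed
qed

lemma negation_walk: "centred_iid_walk M (\<lambda>n \<omega>. - X n \<omega>) \<sigma>"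
proof
  show "indep_vars (\<lambda>_. borel) (\<lambda>n \<omega>. - X n \<omega>) UNIV"
    by (rule indep_vars_compose2[OF indep]) simp
  have "distr M borel (\<lambda>\<omega>. - X n \<omega>) = distr (distr M borel (X n)) borel uminus" for n
    by (subst distr_distr) (auto simp: comp_def)
  then show "distr M borel (\<lambda>\<omega>. - X n \<omega>) = distr M borel (\<lambda>\<omega>. - X 0 \<omega>)" for n
    by (simp add: same_distr[of n])
qed (auto simp: mean_0 square_integrable second_moment sigma_pos)

lemma AE_mostly_negative:
  "AE \<omega> in M. \<forall>\<epsilon>>0. \<exists>\<^sub>F n in sequentially. freq (\<lambda>j. S j \<omega> < 0) n > 1 - \<epsilon>"
proof -
  interpret neg: centred_iid_walk M "\<lambda>n \<omega>. - X n \<omega>" \<sigma> by (rule negation_walk)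
  have "neg.S n \<omega> = - S n \<omega>" for n \<omega>
    unfolding neg.S_def S_def by (simp add: sum_negf)
  with neg.AE_mostly_positive show ?thesis by simp
qed

end

section \<open>Averages along sequences that leave every bounded set\<close>

lemma freq_Not: "n > 0 \<Longrightarrow> freq (\<lambda>j. \<not> P j) n = 1 - freq P n"
  by (simp add: freq_def of_bool_not_iff sum_subtractf diff_divide_distrib del: sum_of_bool_eq)

lemma freq_Suc_le: "freq P (Suc n) \<le> freq P n + 1 / real (Suc n)"
proof -
  have "freq P (Suc n) = (\<Sum>j<n. of_bool (P j)) / real (Suc n) + of_bool (P n) / real (Suc n)"
    by (simp add: freq_def add_divide_distrib del: sum_of_bool_eq)
  also have "of_bool (P n) / real (Suc n) \<le> 1 / real (Suc n)"
    by (intro divide_right_mono) auto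
  also have "(\<Sum>j<n. of_bool (P j)) / real (Suc n) \<le> freq P n"
    unfolding freq_def by (cases "n = 0") (auto intro!: divide_left_mono simp del: sum_of_bool_eq simp: sum_nonneg)
  finally show ?thesis by simp
qed

text \<open>
  A discrete intermediate value argument: from time \<open>n\<close> to \<open>n + 1\<close> the frequency increases by at
  most \<open>1 / (n + 1)\<close>, so on its way up from near \<open>0\<close> to near \<open>1\<close> it cannot jump over a
  neighbourhood of \<open>c\<close>.
\<close>

lemma freq_accumulates_everywhere:
  assumes hi: "\<And>\<epsilon>. \<epsilon> > 0 \<Longrightarrow> \<exists>\<^sub>F n in sequentially. freq P n > 1 - \<epsilon>"
    and lo: "\<And>\<epsilon>. \<epsilon> > 0 \<Longrightarrow> \<exists>\<^sub>F n in sequentially. freq P n < \<epsilon>"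
    and c: "c \<in> {0..1}" and "e > 0"
  shows "\<exists>\<^sub>F n in sequentially. \<bar>freq P n - c\<bar> < e"
  unfolding frequently_sequentially
proof
  fix N :: nat
  obtain N' :: nat where N': "1 / e < real N'" using reals_Archimedean2 by blast
  obtain n1 where n1: "n1 \<ge> max N N'" "freq P n1 < e"
    using lo[OF \<open>e > 0\<close>] unfolding frequently_sequentially by blast
  obtain n2 where n2: "n2 \<ge> n1" "freq P n2 > 1 - e"
    using hi[OF \<open>e > 0\<close>] unfolding frequently_sequentially by blast
  (* Just before this time the frequency is at most c - e, unless the time is n1, where it is
     below e. One step of size less than e does not reach c + e. *)
  define n where "n = (LEAST n. n \<ge> n1 \<and> freq P n > c - e)"
  have n: "n \<ge> n1 \<and> freq P n > c - e"
    unfolding n_def by (rule LeastI[of _ n2]) (use n2 c in auto)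
  have "freq P n < c + e"
  proof (cases "n = n1")
    case True
    then show ?thesis using n1 c by simp
  next
    case False
    then obtain k where k: "n = Suc k" "k \<ge> n1" using n by (cases n) auto
    then have "\<not> (k \<ge> n1 \<and> freq P k > c - e)"
      unfolding n_def by (intro not_less_Least) simp
    with k(2) have "\<not> freq P k > c - e" by simp
    moreover have "1 / real (Suc k) < e"
    proof -
      have "1 / e < real (Suc k)" using N' n1 k by simp
      then show ?thesis using \<open>e > 0\<close> by (simp only: divide_less_eq of_nat_0_less_iff zero_less_Suc mult.commute if_True)
    qed
    ultimately show ?thesis using freq_Suc_le[of P k] \<open>e > 0\<close> unfolding k(1) by linarith
  qed
  with n n1 show "\<exists>n\<ge>N. \<bar>freq P n - c\<bar> < e" by (intro exI[of _ n]) auto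
qed

text \<open>
  If \<open>s\<close> spends a vanishing proportion of time in each bounded set, then in the average
  \<open>g (s j)\<close> may be replaced by its limit at \<open>+\<infinity>\<close> or \<open>-\<infinity>\<close> according to the sign of \<open>s j\<close>: outside
  \<open>[- K, K]\<close> the error \<open>d\<close> is small, inside it is bounded and rarely counted.
\<close>

lemma average_of_escaping_sequence:
  fixes g s :: "_ \<Rightarrow> real"
  assumes bound: "\<And>x. \<bar>g x\<bar> \<le> B" and top: "(g \<longlongrightarrow> L1) at_top" and bot: "(g \<longlongrightarrow> L0) at_bot"
    and escape: "\<And>K. (\<lambda>n. freq (\<lambda>j. \<bar>s j\<bar> \<le> K) n) \<longlonglongrightarrow> 0"
  shows "(\<lambda>n. (\<Sum>j<n. g (s j)) / real n
           - ((1 - freq (\<lambda>j. s j > 0) n) * L0 + freq (\<lambda>j. s j > 0) n * L1)) \<longlonglongrightarrow> 0"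
proof -
  define d where "d x = g x - (if x > 0 then L1 else L0)" for x
  define B' where "B' = B + \<bar>L0\<bar> + \<bar>L1\<bar>"
  have B': "\<bar>d x\<bar> \<le> B'" for x using bound[of x] by (auto simp: d_def B'_def)
  have "B' \<ge> 0" using B'[of 0] by linarith
  have avg: "(\<Sum>j<n. g (s j)) / real n - ((1 - freq (\<lambda>j. s j > 0) n) * L0 + freq (\<lambda>j. s j > 0) n * L1)
      = (\<Sum>j<n. d (s j)) / real n" if "n > 0" for n
  proof -
    have "d (s j) = g (s j) - (L0 + (L1 - L0) * of_bool (s j > 0))" for j by (simp add: d_def)
    then have "(\<Sum>j<n. d (s j)) = (\<Sum>j<n. g (s j)) - (real n * L0 + (L1 - L0) * (\<Sum>j<n. of_bool (s j > 0)))"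
      by (simp add: sum_subtractf sum.distrib sum_distrib_left del: sum_of_bool_eq)
    then show ?thesis using that by (simp add: freq_def field_simps del: sum_of_bool_eq)
  qed
  have "(\<lambda>n. (\<Sum>j<n. d (s j)) / real n) \<longlonglongrightarrow> 0"
  proof (rule LIMSEQ_I)
    fix e :: real assume "e > 0"
    then have "e / 2 > 0" by simp
    have "eventually (\<lambda>x. \<bar>d x\<bar> < e / 2) at_top"
      using tendstoD[OF top \<open>e / 2 > 0\<close>] eventually_gt_at_top[of 0]
      by eventually_elim (simp add: d_def dist_real_def)
    then obtain K1 where K1: "\<And>x. x \<ge> K1 \<Longrightarrow> \<bar>d x\<bar> < e / 2" by (auto simp: eventually_at_top_linorder)
    have "eventually (\<lambda>x. \<bar>d x\<bar> < e / 2) at_bot"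
      using tendstoD[OF bot \<open>e / 2 > 0\<close>] eventually_le_at_bot[of 0]
      by eventually_elim (simp add: d_def dist_real_def)
    then obtain K0 where K0: "\<And>x. x \<le> K0 \<Longrightarrow> \<bar>d x\<bar> < e / 2" by (auto simp: eventually_at_bot_linorder)
    define K where "K = max \<bar>K0\<bar> \<bar>K1\<bar>"
    have pointwise: "\<bar>d x\<bar> \<le> e / 2 + B' * of_bool (\<bar>x\<bar> \<le> K)" for x
    proof (cases "\<bar>x\<bar> \<le> K")
      case True
      then show ?thesis using B'[of x] \<open>e > 0\<close> by simp
    next
      case False
      then have "x \<le> K0 \<or> x \<ge> K1" by (auto simp: K_def)
      then show ?thesis using False K0[of x] K1[of x] by auto
    qed
    have "(\<lambda>n. B' * freq (\<lambda>j. \<bar>s j\<bar> \<le> K) n) \<longlonglongrightarrow> B' * 0" by (intro tendsto_intros escape)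
    then have "eventually (\<lambda>n. B' * freq (\<lambda>j. \<bar>s j\<bar> \<le> K) n < e / 2) sequentially"
      using \<open>e > 0\<close> by (intro order_tendstoD) auto
    with eventually_gt_at_top[of "0::nat"]
    have "eventually (\<lambda>n. norm ((\<Sum>j<n. d (s j)) / real n - 0) < e) sequentially"
    proof eventually_elim
      case (elim n)
      have "\<bar>\<Sum>j<n. d (s j)\<bar> \<le> (\<Sum>j<n. e / 2 + B' * of_bool (\<bar>s j\<bar> \<le> K))"
        by (rule order.trans[OF sum_abs sum_mono[OF pointwise]])
      also have "\<dots> = real n * (e / 2) + B' * (\<Sum>j<n. of_bool (\<bar>s j\<bar> \<le> K))"
        by (simp add: sum.distrib sum_distrib_left del: sum_of_bool_eq)
      finally have "\<bar>\<Sum>j<n. d (s j)\<bar> / real n \<le> (real n * (e / 2) + B' * (\<Sum>j<n. of_bool (\<bar>s j\<bar> \<le> K))) / real n"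
        by (rule divide_right_mono) simp
      also have "\<dots> = e / 2 + B' * freq (\<lambda>j. \<bar>s j\<bar> \<le> K) n"
        using elim(1) by (simp add: freq_def add_divide_distrib del: sum_of_bool_eq)
      finally show ?case using elim(2) by simp
    qed
    then show "\<exists>n0. \<forall>n\<ge>n0. norm ((\<Sum>j<n. d (s j)) / real n - 0) < e"
      by (simp add: eventually_sequentially)
  qed
  then show ?thesis
    by (rule Lim_transform_eventually)
       (rule eventually_mono[OF eventually_gt_at_top[of "0::nat"]], rule avg[symmetric])
qed

lemma average_of_observable:
  fixes \<psi> \<phi> :: "real \<Rightarrow> real"
  assumes \<psi>: "\<And>t. \<psi> t \<in> {0..1}" "(\<psi> \<longlongrightarrow> 1) at_top" "(\<psi> \<longlongrightarrow> 0) at_bot"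
    and escape: "\<And>K. (\<lambda>n. freq (\<lambda>j. \<bar>s j\<bar> \<le> K) n) \<longlonglongrightarrow> 0"
    and \<phi>: "continuous_on {0..1} \<phi>"
  shows "(\<lambda>n. (\<Sum>j<n. \<phi> (\<psi> (s j))) / real n
           - ((1 - freq (\<lambda>j. s j > 0) n) * \<phi> 0 + freq (\<lambda>j. s j > 0) n * \<phi> 1)) \<longlonglongrightarrow> 0"
proof -
  have "bounded (\<phi> ` {0..1})" by (intro compact_imp_bounded compact_continuous_image \<phi>) simp
  then obtain B where B: "\<And>y. y \<in> {0..1} \<Longrightarrow> \<bar>\<phi> y\<bar> \<le> B"
    unfolding bounded_iff by (metis imageI real_norm_def)
  show ?thesis
  proof (rule average_of_escaping_sequence[where g = "\<lambda>t. \<phi> (\<psi> t)", OF _ _ _ escape])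
    show "\<bar>\<phi> (\<psi> t)\<bar> \<le> B" for t by (rule B[OF \<psi>(1)])
    show "((\<lambda>t. \<phi> (\<psi> t)) \<longlongrightarrow> \<phi> 1) at_top"
      by (rule continuous_on_tendsto_compose[OF \<phi> \<psi>(2)]) (use \<psi>(1) in auto)
    show "((\<lambda>t. \<phi> (\<psi> t)) \<longlongrightarrow> \<phi> 0) at_bot"
      by (rule continuous_on_tendsto_compose[OF \<phi> \<psi>(3)]) (use \<psi>(1) in auto)
  qed
qed

section \<open>Weak-star accumulation points\<close>

text \<open>
  Being entered eventually survives finite intersections, and a union inherits it from the
  member that contains \<open>m\<close>. So it can be tested on the generating sets.
\<close>

lemma eventually_in_generated_open:
  assumes "generate_topology_on \<B> U" "m \<in> U"
    and "\<And>B. B \<in> \<B> \<Longrightarrow> m \<in> B \<Longrightarrow> eventually (\<lambda>n. s n \<in> B) F"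
  shows "eventually (\<lambda>n. s n \<in> U) F"
  using assms(1,2)
proof (induction rule: generate_topology_on.induct)
  case (Int a b)
  then have "eventually (\<lambda>n. s n \<in> a \<and> s n \<in> b) F" by (intro eventually_conj) auto
  then show ?case by simp
next
  case (UN K)
  then obtain k where k: "k \<in> K" "m \<in> k" by blast
  with UN have "eventually (\<lambda>n. s n \<in> k) F" by blast
  then show ?case by (rule eventually_mono) (use k in auto)
qed (use assms(3) in auto)

text \<open>
  A filter plays the role of a subsequence along which \<open>u\<close> converges to its accumulation point
  \<open>c\<close>.
\<close>

lemma sub_filter_of_frequently:
  fixes u :: "nat \<Rightarrow> real"
  assumes "\<And>e. e > 0 \<Longrightarrow> \<exists>\<^sub>F n in sequentially. \<bar>u n - c\<bar> < e"
  obtains F where "F \<noteq> bot" "F \<le> sequentially" "(u \<longlongrightarrow> c) F"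
proof
  let ?F = "inf sequentially (filtercomap u (nhds c))"
  show "?F \<le> sequentially" by simp
  show "(u \<longlongrightarrow> c) ?F"
    unfolding filterlim_def by (rule order.trans[OF filtermap_mono filtermap_filtercomap]) simp
  show "?F \<noteq> bot"
  proof
    assume "?F = bot"
    then have "eventually (\<lambda>_. False) ?F" by (simp add: trivial_limit_def)
    then obtain P Q where P: "eventually P sequentially" and Q: "eventually Q (nhds c)"
      and PQ: "\<And>n. P n \<Longrightarrow> Q (u n) \<Longrightarrow> False"
      unfolding eventually_inf eventually_filtercomap by blast
    obtain e where e: "e > 0" "\<And>y. dist y c < e \<Longrightarrow> Q y" using Q by (auto simp: eventually_nhds_metric)
    have "\<exists>\<^sub>F n in sequentially. \<bar>u n - c\<bar> < e \<and> P n"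
      by (rule frequently_eventually_frequently[OF assms[OF e(1)] P])
    then show False using PQ e(2) by (auto simp: dist_real_def dest!: frequently_ex)
  qed
qed

lemma integral_finite_support:
  fixes f :: "'b \<Rightarrow> real"
  assumes "finite_measure M" "finite Z" and sing: "\<And>z. z \<in> Z \<Longrightarrow> {z} \<in> sets M"
    and AE: "AE x in M. x \<in> Z" and [measurable]: "f \<in> borel_measurable M"
  shows "integral\<^sup>L M f = (\<Sum>z\<in>Z. f z * measure M {z})"
proof -
  interpret finite_measure M by fact
  have int: "integrable M (\<lambda>x. f z * indicator {z} x)" if "z \<in> Z" for z
    using sing[OF that] by (intro integrable_mult_right) (auto simp: integrable_indicator_iff less_top[symmetric])
  have "integral\<^sup>L M f = (\<integral>x. (\<Sum>z\<in>Z. f z * indicator {z} x) \<partial>M)"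
  proof (rule integral_cong_AE)
    show "(\<lambda>x. \<Sum>z\<in>Z. f z * indicator {z} x) \<in> borel_measurable M"
      by (intro borel_measurable_sum borel_measurable_integrable int)
    show "AE x in M. f x = (\<Sum>z\<in>Z. f z * indicator {z} x)"
      using AE
    proof eventually_elim
      case (elim x)
      have "(\<Sum>z\<in>Z. f z * indicator {z} x) = (\<Sum>z\<in>Z. if z = x then f x else 0)"
        by (rule sum.cong) (auto simp: indicator_def)
      then show ?case using elim assms(2) by simp
    qed
  qed simp
  also have "\<dots> = (\<Sum>z\<in>Z. \<integral>x. f z * indicator {z} x \<partial>M)"
    by (rule Bochner_Integration.integral_sum) (rule int)
  also have "\<dots> = (\<Sum>z\<in>Z. f z * measure M {z})"
    by (rule sum.cong) (auto simp: sing sets.sets_into_space[OF sing] Int_absorb2)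
  finally show ?thesis .
qed

lemma singleton_in_unit_borel: "x \<in> {0..1} \<Longrightarrow> {x} \<in> sets unit_borel"
  by (auto simp: unit_borel_def sets_restrict_space_iff)

lemma space_unit_borel: "space unit_borel = {0..1}"
  by (simp add: unit_borel_def space_restrict_space)

lemma borel_measurable_unit_borel:
  "continuous_on {0..1} \<phi> \<Longrightarrow> \<phi> \<in> borel_measurable unit_borel"
  unfolding unit_borel_def by (rule borel_measurable_continuous_on_restrict)

definition dirac_segment :: "real \<Rightarrow> real measure" where
  "dirac_segment l = add_measure (scale_measure (ennreal l) (dirac 0)) (scale_measure (ennreal (1 - l)) (dirac 1))"

lemma sets_dirac_segment: "sets (dirac_segment l) = sets unit_borel"
  by (simp add: dirac_segment_def dirac_def)

lemma emeasure_dirac_segment: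
  assumes "A \<in> sets unit_borel"
  shows "emeasure (dirac_segment l) A = ennreal l * indicator A 0 + ennreal (1 - l) * indicator A 1"
  unfolding dirac_segment_def
  by (subst emeasure_add_measure) (auto simp: assms dirac_def)

lemma dirac_segment_in_unit_prob_measures:
  assumes "l \<in> {0..1}"
  shows "dirac_segment l \<in> unit_prob_measures"
proof -
  have sp: "space (dirac_segment l) = {0..1}"
    using sets_eq_imp_space_eq[OF sets_dirac_segment] by (simp add: space_unit_borel)
  have "emeasure (dirac_segment l) {0..1} = ennreal l * indicator {0..1} (0::real) + ennreal (1 - l) * indicator {0..1} (1::real)"
    by (rule emeasure_dirac_segment) (metis sets.top space_unit_borel)
  also have "\<dots> = 1" using assms by (simp flip: ennreal_plus)
  finally show ?thesis
    by (auto simp: unit_prob_measures_def sets_dirac_segment sp intro!: prob_spaceI)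
qed

lemma integral_dirac_segment:
  assumes "l \<in> {0..1}" "continuous_on {0..1} \<phi>"
  shows "integral\<^sup>L (dirac_segment l) \<phi> = l * \<phi> 0 + (1 - l) * \<phi> 1"
proof -
  interpret prob_space "dirac_segment l"
    using dirac_segment_in_unit_prob_measures[OF assms(1)] by (simp add: unit_prob_measures_def)
  have sets01: "{0} \<in> sets unit_borel" "{1} \<in> sets unit_borel"
    by (auto intro: singleton_in_unit_borel)
  have em: "measure (dirac_segment l) {0} = l" "measure (dirac_segment l) {1} = 1 - l"
    using assms(1) by (auto simp: measure_def emeasure_dirac_segment sets01)
  have "space unit_borel - {0, 1} \<in> sets unit_borel" using sets01 by (metis insert_is_Un sets.Un sets.compl_sets)
  then have "emeasure (dirac_segment l) (space unit_borel - {0, 1}) = 0"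
    by (subst emeasure_dirac_segment) auto
  then have "AE x in dirac_segment l. x \<in> {0, 1}"
    using \<open>space unit_borel - {0, 1} \<in> _\<close> sets_eq_imp_space_eq[OF sets_dirac_segment[of l]]
    by (intro AE_I[of _ _ "space unit_borel - {0, 1}"]) (auto simp: sets_dirac_segment)
  moreover have "\<phi> \<in> borel_measurable (dirac_segment l)"
    using borel_measurable_unit_borel[OF assms(2)] by (simp cong: measurable_cong_sets add: sets_dirac_segment)
  ultimately have "integral\<^sup>L (dirac_segment l) \<phi> = (\<Sum>z\<in>{0, 1}. \<phi> z * measure (dirac_segment l) {z})"
    by (intro integral_finite_support) (auto simp: sets_dirac_segment intro: singleton_in_unit_borel finite_measure_axioms)
  then show ?thesis by (simp add: em mult.commute)
qed

text \<open>
  The two atoms determine the measure, and \<open>l\<close> is the mass of \<open>{0}\<close>.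
\<close>

lemma dirac_segment_eqI:
  assumes m: "m \<in> unit_prob_measures" and supp: "AE x in m. x \<in> {0, 1}"
  shows "\<exists>l\<in>{0..1}. m = dirac_segment l"
proof -
  have sets: "sets m = sets unit_borel" using m by (simp add: unit_prob_measures_def)
  interpret prob_space m using m by (simp add: unit_prob_measures_def)
  have sets01: "{0} \<in> events" "{1} \<in> events"
    by (auto simp: sets intro: singleton_in_unit_borel)
  have "1 = prob {0, 1}" using supp prob_eq_1[of "{0, 1}"] sets01 by (metis insert_is_Un sets.Un)
  also have "{0, 1} = {0::real} \<union> {1}" by auto
  also have "prob \<dots> = prob {0} + prob {1}" by (rule finite_measure_Union) (auto simp: sets01)
  finally have p1: "prob {1} = 1 - prob {0}" by simp
  have "emeasure m A = emeasure (dirac_segment (prob {0})) A" if A: "A \<in> events" for A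
  proof -
    have *: "emeasure m (A \<inter> {x}) = emeasure m {x} * indicator A x" for x
      by (cases "x \<in> A") auto
    have "emeasure m A = emeasure m ((A \<inter> {0}) \<union> (A \<inter> {1}))"
      using A sets01 by (intro emeasure_eq_AE eventually_mono[OF supp]) auto
    also have "\<dots> = emeasure m (A \<inter> {0}) + emeasure m (A \<inter> {1})"
      using A sets01 by (intro plus_emeasure[symmetric]) auto
    also have "\<dots> = emeasure (dirac_segment (prob {0})) A"
      using A unfolding * by (simp add: emeasure_dirac_segment sets emeasure_eq_measure flip: p1)
    finally show ?thesis .
  qed
  then have "m = dirac_segment (prob {0})"
    by (intro measure_eqI) (auto simp: sets sets_dirac_segment)
  then show ?thesis by (intro bexI[of _ "prob {0}"]) auto
qed

lemma integral_empirical_measure: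
  assumes e: "empirical_measure f \<omega> x n \<in> unit_prob_measures" and orbit: "\<And>j. fibre_iter f j \<omega> x \<in> {0..1}"
    and \<phi>: "continuous_on {0..1} \<phi>"
  shows "integral\<^sup>L (empirical_measure f \<omega> x n) \<phi> = (\<Sum>j<n. \<phi> (fibre_iter f j \<omega> x)) / real n"
proof -
  let ?e = "empirical_measure f \<omega> x n" and ?z = "\<lambda>j. fibre_iter f j \<omega> x"
  define Z where "Z = ?z ` {..<n}"
  have Z: "finite Z" "Z \<subseteq> {0..1}" using orbit by (auto simp: Z_def)
  interpret prob_space ?e using e by (simp add: unit_prob_measures_def)
  have sets: "sets ?e = sets unit_borel" using e by (simp add: unit_prob_measures_def)
  have "Z \<in> sets unit_borel"
    using Z by (intro sets.countable[OF singleton_in_unit_borel] countable_finite) auto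
  then have compl: "space unit_borel - Z \<in> sets unit_borel" by (rule sets.compl_sets)
  then have "emeasure ?e (space unit_borel - Z) = 0"
    by (subst emeasure_empirical_measure) (auto simp: Z_def)
  then have AE: "AE y in ?e. y \<in> Z"
    using compl sets_eq_imp_space_eq[OF sets]
    by (intro AE_I[of _ _ "space unit_borel - Z"]) (auto simp: sets)
  have meas: "measure ?e {y} = (\<Sum>j<n. indicator {y} (?z j)) / real n" if "y \<in> Z" for y
  proof -
    have "emeasure ?e {y} = ennreal (1 / real n) * (\<Sum>j<n. indicator {y} (?z j))"
      using that Z by (intro emeasure_empirical_measure singleton_in_unit_borel) auto
    also have "(\<Sum>j<n. indicator {y} (?z j) :: ennreal) = ennreal (\<Sum>j<n. indicator {y} (?z j))"
      unfolding ennreal_indicator[symmetric] by (rule sum_ennreal) simp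
    also have "ennreal (1 / real n) * \<dots> = ennreal (1 / real n * (\<Sum>j<n. indicator {y} (?z j)))"
      by (rule ennreal_mult[symmetric]) (auto intro: sum_nonneg)
    finally have "measure ?e {y} = enn2real (ennreal (1 / real n * (\<Sum>j<n. indicator {y} (?z j))))"
      unfolding measure_def by (rule arg_cong)
    also have "\<dots> = 1 / real n * (\<Sum>j<n. indicator {y} (?z j))"
      by (rule enn2real_ennreal) (intro mult_nonneg_nonneg sum_nonneg, auto)
    finally show ?thesis by simp
  qed
  have "integral\<^sup>L ?e \<phi> = (\<Sum>y\<in>Z. \<phi> y * measure ?e {y})"
  proof (rule integral_finite_support[OF _ Z(1) _ AE])
    show "{z} \<in> sets ?e" if "z \<in> Z" for z using that Z by (auto simp: sets intro: singleton_in_unit_borel)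
    show "\<phi> \<in> borel_measurable ?e"
      using borel_measurable_unit_borel[OF \<phi>] by (simp cong: measurable_cong_sets add: sets)
  qed (rule finite_measure_axioms)
  also have "\<dots> = (\<Sum>y\<in>Z. \<Sum>j<n. \<phi> y * indicator {y} (?z j)) / real n"
    by (simp add: meas sum_distrib_left sum_divide_distrib cong: sum.cong del: sum_mult_indicator)
  also have "(\<Sum>y\<in>Z. \<Sum>j<n. \<phi> y * indicator {y} (?z j)) = (\<Sum>j<n. \<Sum>y\<in>Z. \<phi> y * indicator {y} (?z j))"
    by (rule sum.swap)
  also have "\<dots> = (\<Sum>j<n. \<phi> (?z j))"
  proof (rule sum.cong[OF refl])
    fix j assume "j \<in> {..<n}"
    then have "?z j \<in> Z" by (auto simp: Z_def)
    have "(\<Sum>y\<in>Z. \<phi> y * indicator {y} (?z j)) = (\<Sum>y\<in>Z. if y = ?z j then \<phi> (?z j) else 0)"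
      by (rule sum.cong) (auto simp: indicator_def)
    then show "(\<Sum>y\<in>Z. \<phi> y * indicator {y} (?z j)) = \<phi> (?z j)" using \<open>?z j \<in> Z\<close> Z(1) by simp
  qed
  finally show ?thesis .
qed

text \<open>
  Write \<open>u\<close> for the frequency of \<open>s j > 0\<close>. By \<open>average_of_observable\<close>, integrals against the
  \<open>n\<close>-th empirical measure are close to integrals against \<open>(1 - u n) \<delta>\<^sub>0 + u n \<delta>\<^sub>1\<close>. Hence every
  accumulation point \<open>1 - l\<close> of \<open>u\<close> yields the accumulation point \<open>l \<delta>\<^sub>0 + (1 - l) \<delta>\<^sub>1\<close> of the
  empirical measures. Conversely, the observable \<open>y (1 - y)\<close> vanishes at both endpoints, so its
  empirical averages tend to \<open>0\<close>. An accumulation point integrates it to \<open>0\<close> and is therefore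
  concentrated on \<open>{0, 1}\<close>.
\<close>

lemma limit_measures_eq_segment:
  fixes \<psi> :: "real \<Rightarrow> real"
  assumes emp: "\<And>n. n \<ge> 1 \<Longrightarrow> empirical_measure f \<omega> x n \<in> unit_prob_measures"
    and orbit: "\<And>j. fibre_iter f j \<omega> x = \<psi> (s j)"
    and \<psi>: "\<And>t. \<psi> t \<in> {0..1}" "(\<psi> \<longlongrightarrow> 1) at_top" "(\<psi> \<longlongrightarrow> 0) at_bot"
    and escape: "\<And>K. (\<lambda>n. freq (\<lambda>j. \<bar>s j\<bar> \<le> K) n) \<longlonglongrightarrow> 0"
    and dense: "\<And>c e. c \<in> {0..1} \<Longrightarrow> e > 0 \<Longrightarrow> \<exists>\<^sub>F n in sequentially. \<bar>freq (\<lambda>j. s j > 0) n - c\<bar> < e"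
  shows "limit_measures f \<omega> x = dirac_segment ` {0..1}"
proof -
  let ?e = "empirical_measure f \<omega> x" and ?u = "\<lambda>n. freq (\<lambda>j. s j > 0) n"
  let ?B = "{{\<mu> \<in> unit_prob_measures. integral\<^sup>L \<mu> \<phi> \<in> U} | \<phi> U.
        continuous_on {0..1} \<phi> \<and> open (U :: real set)}"
  have avg: "(\<lambda>n. integral\<^sup>L (?e n) \<phi> - ((1 - ?u n) * \<phi> 0 + ?u n * \<phi> 1)) \<longlonglongrightarrow> 0"
    if \<phi>: "continuous_on {0..1} \<phi>" for \<phi>
  proof (rule Lim_transform_eventually[OF average_of_observable[OF \<psi> escape \<phi>]])
    have "integral\<^sup>L (?e n) \<phi> = (\<Sum>j<n. \<phi> (\<psi> (s j))) / real n" if "n \<ge> 1" for n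
      using integral_empirical_measure[OF emp[OF that] _ \<phi>] \<psi>(1) by (simp add: orbit)
    then show "eventually (\<lambda>n. (\<Sum>j<n. \<phi> (\<psi> (s j))) / real n - ((1 - ?u n) * \<phi> 0 + ?u n * \<phi> 1)
        = integral\<^sup>L (?e n) \<phi> - ((1 - ?u n) * \<phi> 0 + ?u n * \<phi> 1)) sequentially"
      by (intro eventually_mono[OF eventually_ge_at_top[of 1]]) simp
  qed
  show ?thesis
  proof (intro set_eqI iffI)
    fix m assume "m \<in> dirac_segment ` {0..1}"
    then obtain l where l: "l \<in> {0..1}" "m = dirac_segment l" by blast
    have "1 - l \<in> {0..1}" using l(1) by simp
    obtain F where F: "F \<noteq> bot" "F \<le> sequentially" "(?u \<longlongrightarrow> 1 - l) F"
      by (rule sub_filter_of_frequently[of ?u "1 - l", OF dense[OF \<open>1 - l \<in> {0..1}\<close>]])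
    have m: "m \<in> unit_prob_measures" using l dirac_segment_in_unit_prob_measures by simp
    have basis: "eventually (\<lambda>n. ?e n \<in> W) F" if "W \<in> ?B" "m \<in> W" for W
    proof -
      obtain \<phi> :: "real \<Rightarrow> real" and U :: "real set" where W: "W = {\<mu> \<in> unit_prob_measures. integral\<^sup>L \<mu> \<phi> \<in> U}"
        "continuous_on {0..1} \<phi>" "open U" using \<open>W \<in> ?B\<close> by blast
      have "((\<lambda>n. (integral\<^sup>L (?e n) \<phi> - ((1 - ?u n) * \<phi> 0 + ?u n * \<phi> 1)) + ((1 - ?u n) * \<phi> 0 + ?u n * \<phi> 1))
          \<longlongrightarrow> 0 + ((1 - (1 - l)) * \<phi> 0 + (1 - l) * \<phi> 1)) F"
        by (intro tendsto_add tendsto_mult tendsto_diff tendsto_const F(3) tendsto_mono[OF F(2) avg[OF W(2)]])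
      then have "((\<lambda>n. integral\<^sup>L (?e n) \<phi>) \<longlongrightarrow> integral\<^sup>L m \<phi>) F"
        using integral_dirac_segment[OF l(1) W(2)] by (simp add: l(2))
      then have "eventually (\<lambda>n. integral\<^sup>L (?e n) \<phi> \<in> U) F"
        using W \<open>m \<in> W\<close> by (intro topological_tendstoD) auto
      moreover have "eventually (\<lambda>n. n \<ge> 1) F"
        using F(2) eventually_ge_at_top by (rule filter_leD)
      ultimately show ?thesis by eventually_elim (simp add: W(1) emp)
    qed
    have "\<exists>\<^sub>F n in sequentially. ?e n \<in> U" if U: "openin weak_star_topology U" "m \<in> U" for U
    proof -
      have "generate_topology_on ?B U"
        using U(1) unfolding weak_star_topology_def openin_topology_generated_by_iff .
      then have "eventually (\<lambda>n. ?e n \<in> U) F"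
        by (rule eventually_in_generated_open[OF _ U(2) basis])
      then have "\<exists>\<^sub>F n in F. ?e n \<in> U" by (rule eventually_frequently[OF F(1)])
      then show ?thesis using F(2) unfolding frequently_def by (meson filter_leD)
    qed
    then show "m \<in> limit_measures f \<omega> x"
      using m by (simp add: limit_measures_def accumulation_points_def topspace_weak_star_topology)
  next
    fix m assume "m \<in> limit_measures f \<omega> x"
    then have m: "m \<in> unit_prob_measures"
      and acc: "\<And>U. openin weak_star_topology U \<Longrightarrow> m \<in> U \<Longrightarrow> \<exists>\<^sub>F n in sequentially. ?e n \<in> U"
      by (auto simp: limit_measures_def accumulation_points_def topspace_weak_star_topology)
    interpret prob_space m using m by (simp add: unit_prob_measures_def)
    have sets: "sets m = sets unit_borel" using m by (simp add: unit_prob_measures_def)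
    have sp: "space m = {0..1}" using sets_eq_imp_space_eq[OF sets] by (simp add: space_unit_borel)
    let ?\<phi> = "\<lambda>y::real. y * (1 - y)"
    have \<phi>: "continuous_on {0..1} ?\<phi>" by (intro continuous_intros)
    have "integral\<^sup>L m ?\<phi> = 0"
    proof (rule ccontr)
      define e where "e = \<bar>integral\<^sup>L m ?\<phi>\<bar> / 2"
      assume "integral\<^sup>L m ?\<phi> \<noteq> 0"
      then have "e > 0" by (simp add: e_def)
      let ?W = "{\<mu> \<in> unit_prob_measures. integral\<^sup>L \<mu> ?\<phi> \<in> ball (integral\<^sup>L m ?\<phi>) e}"
      have "?W \<in> ?B"
        by (intro CollectI exI[of _ ?\<phi>] exI[of _ "ball (integral\<^sup>L m ?\<phi>) e"] conjI refl \<phi>) simp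
      then have "openin weak_star_topology ?W"
        unfolding weak_star_topology_def by (rule topology_generated_by_Basis)
      moreover have "m \<in> ?W" using m \<open>e > 0\<close> by simp
      ultimately have "\<exists>\<^sub>F n in sequentially. ?e n \<in> ?W" by (rule acc)
      moreover have "eventually (\<lambda>n. \<bar>integral\<^sup>L (?e n) ?\<phi>\<bar> < e) sequentially"
        using tendstoD[OF avg[OF \<phi>] \<open>e > 0\<close>] by (simp add: dist_real_def)
      ultimately have "\<exists>\<^sub>F n in sequentially. ?e n \<in> ?W \<and> \<bar>integral\<^sup>L (?e n) ?\<phi>\<bar> < e"
        by (rule frequently_eventually_frequently)
      then obtain n where "?e n \<in> ?W" "\<bar>integral\<^sup>L (?e n) ?\<phi>\<bar> < e" by (auto dest: frequently_ex)
      then have "\<bar>integral\<^sup>L m ?\<phi> - integral\<^sup>L (?e n) ?\<phi>\<bar> < e" "\<bar>integral\<^sup>L (?e n) ?\<phi>\<bar> < e"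
        by (auto simp: dist_real_def)
      then show False unfolding e_def by linarith
    qed
    moreover have [measurable]: "?\<phi> \<in> borel_measurable m"
      using borel_measurable_unit_borel[OF \<phi>] by (simp cong: measurable_cong_sets add: sets)
    moreover have nonneg: "AE y in m. 0 \<le> ?\<phi> y" by (rule AE_I2) (simp add: sp)
    moreover have "integrable m ?\<phi>"
      by (rule integrable_const_bound[where B = 1], rule AE_I2) (auto simp: sp abs_mult intro!: mult_le_one)
    ultimately have "AE y in m. ?\<phi> y = 0" by (subst (asm) integral_nonneg_eq_0_iff_AE) auto
    then have "AE y in m. y \<in> {0, 1}" by eventually_elim auto
    from dirac_segment_eqI[OF m this] show "m \<in> dirac_segment ` {0..1}" by blast
  qed
qed

section \<open>The skew product of Moebius maps\<close>

text \<open>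
  In the coordinate \<open>y = ln (x / (1 - x))\<close> the map with multiplier \<open>b\<close> is the translation by
  \<open>ln b\<close>. Multipliers multiply under composition, so the \<open>n\<close>-th iterate is the map whose
  multiplier is the exponential of the sum of the logarithms. The formula also covers the
  endpoints, where \<open>y\<close> is infinite.
\<close>

lemma fibre_iter_mobius:
  assumes pos: "\<And>\<omega>. a \<omega> > 0" and x: "x \<in> {0..1}"
  shows "fibre_iter (mobius_fibre a) n \<omega> x =
    exp (\<Sum>i<n. ln (a ((shift ^^ i) \<omega>))) * x / (1 + (exp (\<Sum>i<n. ln (a ((shift ^^ i) \<omega>))) - 1) * x)"
proof (induction n)
  case (Suc n)
  define b where "b = a ((shift ^^ n) \<omega>)"
  define E where "E = exp (\<Sum>i<n. ln (a ((shift ^^ i) \<omega>)))"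
  define D where "D = 1 + (E - 1) * x"
  have b: "b > 0" by (simp add: b_def pos)
  have mult: "exp (\<Sum>i<Suc n. ln (a ((shift ^^ i) \<omega>))) = E * b"
    using b by (simp add: E_def b_def exp_add)
  have D: "D > 0"
    using mobius_fibre_unit_interval(1)[of "\<lambda>_. E" undefined x] x by (simp add: D_def E_def)
  have "fibre_iter (mobius_fibre a) (Suc n) \<omega> x = b * (E * x / D) / (1 + (b - 1) * (E * x / D))"
    by (simp add: mobius_fibre_def[of a "(shift ^^ n) \<omega>"] Suc b_def E_def D_def)
  also have "\<dots> = b * E * x / (D + (b - 1) * (E * x))"
    using D by (simp add: field_simps)
  also have "D + (b - 1) * (E * x) = 1 + (E * b - 1) * x" by (simp add: D_def algebra_simps)
  finally show ?case unfolding mult by (simp add: mult.commute)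
qed simp

lemma mobius_limits:
  assumes "x \<in> {0<..<1::real}"
  shows "((\<lambda>t. exp t * x / (1 + (exp t - 1) * x)) \<longlongrightarrow> 1) at_top"
    and "((\<lambda>t. exp t * x / (1 + (exp t - 1) * x)) \<longlongrightarrow> 0) at_bot"
proof -
  have den: "1 + (exp t - 1) * x > 0" for t :: real
    using mobius_fibre_unit_interval(1)[of "\<lambda>_. exp t" undefined x] assms by simp
  have "((\<lambda>t::real. x / (exp (- t) * (1 - x) + x)) \<longlongrightarrow> x / (0 * (1 - x) + x)) at_top"
    using assms
    by (intro tendsto_intros filterlim_compose[OF exp_at_bot] filterlim_uminus_at_bot_at_top) auto
  moreover have "exp t * x / (1 + (exp t - 1) * x) = x / (exp (- t) * (1 - x) + x)" for t
  proof -
    have "1 + (exp t - 1) * x = exp t * (exp (- t) * (1 - x) + x)"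
      by (simp add: algebra_simps flip: exp_add)
    then show ?thesis by simp
  qed
  ultimately show "((\<lambda>t. exp t * x / (1 + (exp t - 1) * x)) \<longlongrightarrow> 1) at_top"
    using assms by simp
  have "((\<lambda>t::real. exp t * x / (1 + (exp t - 1) * x)) \<longlongrightarrow> 0 * x / (1 + (0 - 1) * x)) at_bot"
    using assms by (intro tendsto_intros exp_at_bot) auto
  then show "((\<lambda>t. exp t * x / (1 + (exp t - 1) * x)) \<longlongrightarrow> 0) at_bot" by simp
qed

lemma bernoulli_coordinates_indep:
  "prob_space.indep_vars (bernoulli_measure p) (\<lambda>_. measure_pmf p) (\<lambda>i \<omega>. \<omega> i) UNIV"
proof -
  interpret prob_space "bernoulli_measure p"
    unfolding bernoulli_measure_def by (rule prob_space_PiM) (rule prob_space_measure_pmf)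
  have comp: "distr (bernoulli_measure p) (measure_pmf p) (\<lambda>\<omega>. \<omega> i) = measure_pmf p" for i
    unfolding bernoulli_measure_def by (rule distr_PiM_component) (auto intro: prob_space_measure_pmf)
  show ?thesis
  proof (subst indep_vars_iff_distr_eq_PiM')
    show "(\<lambda>\<omega>. \<omega> i) \<in> bernoulli_measure p \<rightarrow>\<^sub>M measure_pmf p" for i
      unfolding bernoulli_measure_def by measurable
    show "distr (bernoulli_measure p) (Pi\<^sub>M UNIV (\<lambda>i. measure_pmf p)) (\<lambda>x. \<lambda>i\<in>UNIV. x i) =
        Pi\<^sub>M UNIV (\<lambda>i. distr (bernoulli_measure p) (measure_pmf p) (\<lambda>\<omega>. \<omega> i))"
      unfolding comp by (simp add: bernoulli_measure_def restrict_UNIV)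
  qed auto
qed

text \<open>
  The exceptional points lie in \<open>N \<times> [0, 1]\<close>, for a measurable null set \<open>N\<close> outside which \<open>P\<close>
  holds, or have second coordinate \<open>0\<close> or \<open>1\<close>. These sets are measurable in the product even if
  \<open>P\<close> is not.
\<close>

lemma AE_pair_lebesgue_unit:
  assumes "prob_space M" and "AE \<omega> in M. P \<omega>"
  shows "AE z in M \<Otimes>\<^sub>M lebesgue_on {0..1::real}. P (fst z) \<and> snd z \<in> {0<..<1}"
proof -
  interpret M: prob_space M by fact
  let ?L = "lebesgue_on {0..1::real}"
  interpret L: finite_measure ?L
    by (rule finite_measureI) (simp add: emeasure_restrict_space space_restrict_space)
  interpret pair_sigma_finite M ?L ..
  obtain N where N: "N \<in> null_sets M" "{\<omega> \<in> space M. \<not> P \<omega>} \<subseteq> N"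
    using assms(2) by (auto elim: AE_E2 simp: eventually_ae_filter)
  have Lsets: "{0, 1} \<in> sets ?L" by (auto simp: sets_restrict_space_iff)
  have "AE x in ?L. x \<notin> {0, 1}"
    by (rule AE_not_in) (auto simp: null_sets_def Lsets emeasure_restrict_space emeasure_lborel_countable)
  moreover have "AE \<omega> in M. \<omega> \<notin> N" by (rule AE_not_in[OF N(1)])
  ultimately have AE: "AE \<omega> in M. AE x in ?L. \<omega> \<notin> N \<and> x \<notin> {0, 1}" by auto
  have "{z \<in> space (M \<Otimes>\<^sub>M ?L). fst z \<notin> N \<and> snd z \<notin> {0, 1}} = (space M - N) \<times> (space ?L - {0, 1})"
    by (auto simp: space_pair_measure)
  also have "\<dots> \<in> sets (M \<Otimes>\<^sub>M ?L)"
    using N(1) Lsets by (intro pair_measureI sets.compl_sets) auto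
  finally have "AE z in M \<Otimes>\<^sub>M ?L. fst z \<notin> N \<and> snd z \<notin> {0, 1}"
    by (rule AE_pair_measure) (use AE in simp)
  then show ?thesis
    using AE_space
  proof eventually_elim
    case (elim z)
    then show ?case using N(2) by (auto simp: space_pair_measure space_restrict_space)
  qed
qed

text \<open>
  A limit of \<open>v\<close> would be a limit of \<open>u\<close> and thus equal to both of its accumulation points \<open>0\<close>
  and \<open>1\<close>.
\<close>

lemma not_convergent_if_accumulates_0_1:
  fixes u v :: "nat \<Rightarrow> real"
  assumes dense: "\<And>c e. c \<in> {0..1} \<Longrightarrow> e > 0 \<Longrightarrow> \<exists>\<^sub>F n in sequentially. \<bar>u n - c\<bar> < e"
    and close: "(\<lambda>n. v n - u n) \<longlonglongrightarrow> 0"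
  shows "\<not> convergent v"
proof
  assume "convergent v"
  then obtain L where "v \<longlonglongrightarrow> L" by (auto simp: convergent_def)
  from tendsto_diff[OF this close] have u: "u \<longlonglongrightarrow> L" by simp
  have "L = c" if c: "c \<in> {0..1}" for c
  proof -
    obtain F where F: "F \<noteq> bot" "F \<le> sequentially" "(u \<longlongrightarrow> c) F"
      by (rule sub_filter_of_frequently[of u c, OF dense[OF c]])
    from tendsto_unique[OF F(1) tendsto_mono[OF F(2) u] F(3)] show ?thesis .
  qed
  from this[of 0] this[of 1] show False by simp
qed

text \<open>
  The steps of the walk are \<open>X i \<omega> = ln (a (\<tau>\<^sup>i \<omega>))\<close>, a function of the coordinate \<open>\<omega> i\<close> alone.
  The set of good \<open>\<omega>\<close> does not depend on \<open>x\<close>, which gives the statement for every \<open>x\<close> in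
  \<open>(0, 1)\<close> and, by taking the identity as the observable, also the statement for almost every
  pair \<open>(\<omega>, x)\<close>.
\<close>

theorem proposition9:
  fixes p :: "'a::countable pmf"
    and a :: "(nat \<Rightarrow> 'a) \<Rightarrow> real"
  assumes full_support: "set_pmf p = UNIV"
    and meas: "a \<in> borel_measurable (bernoulli_measure p)"
    and pos: "\<And>\<omega>. a \<omega> > 0"
    and zero_coord: "\<And>\<omega> \<omega>'. \<omega> 0 = \<omega>' 0 \<Longrightarrow> a \<omega> = a \<omega>'"
    and mean_zero: "has_bochner_integral (bernoulli_measure p) (\<lambda>\<omega>. ln (a \<omega>)) 0"
    and not_one: "\<And>\<omega>. a \<omega> \<noteq> 1"
    and second_moment: "integrable (bernoulli_measure p) (\<lambda>\<omega>. (ln (a \<omega>))\<^sup>2)"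
  shows "historical_behavior_ae (bernoulli_measure p \<Otimes>\<^sub>M lebesgue_on {0..1})
           (skew_product (mobius_fibre a)) \<and>
         (\<forall>x\<in>{0<..<1}. AE \<omega> in bernoulli_measure p.
           limit_measures (mobius_fibre a) \<omega> x =
             {add_measure (scale_measure (ennreal l) (dirac 0))
                (scale_measure (ennreal (1 - l)) (dirac 1)) | l. l \<in> {0..1}})"
proof -
  let ?M = "bernoulli_measure p"
  interpret prob_space ?M
    unfolding bernoulli_measure_def by (rule prob_space_PiM) (rule prob_space_measure_pmf)
  define g where "g b = ln (a (\<lambda>_. b))" for b
  define X where "X i \<omega> = g (\<omega> i)" for i :: nat and \<omega>
  have shift_pow: "(shift ^^ i) \<omega> k = \<omega> (k + i)" for i k :: nat and \<omega> :: "nat \<Rightarrow> 'a"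
    by (induction i arbitrary: k) (simp_all add: shift_def)
  have X_eq: "X i \<omega> = ln (a ((shift ^^ i) \<omega>))" for i \<omega>
    unfolding X_def g_def by (intro arg_cong[where f = ln] zero_coord) (simp add: shift_pow)
  have X0: "X 0 = (\<lambda>\<omega>. ln (a \<omega>))" by (simp add: X_eq fun_eq_iff)
  have coord [measurable]: "(\<lambda>\<omega>. \<omega> i) \<in> ?M \<rightarrow>\<^sub>M measure_pmf p" for i
    unfolding bernoulli_measure_def by measurable
  have X_meas [measurable]: "X i \<in> borel_measurable ?M" for i
    unfolding X_def[abs_def] by (rule measurable_compose[OF coord]) simp
  have distr_X: "distr ?M borel (X i) = distr (measure_pmf p) borel g" for i
  proof -
    have "distr ?M (measure_pmf p) (\<lambda>\<omega>. \<omega> i) = measure_pmf p"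
      unfolding bernoulli_measure_def by (rule distr_PiM_component) (auto intro: prob_space_measure_pmf)
    then have "distr (measure_pmf p) borel g = distr (distr ?M (measure_pmf p) (\<lambda>\<omega>. \<omega> i)) borel g" by simp
    also have "\<dots> = distr ?M borel (X i)"
      by (subst distr_distr[OF _ coord]) (auto simp: comp_def X_def[abs_def])
    finally show ?thesis by simp
  qed
  (* The variance is positive because ln (a w) never vanishes. *)
  define v where "v = expectation (\<lambda>\<omega>. (X 0 \<omega>)\<^sup>2)"
  have sq0: "integrable ?M (\<lambda>\<omega>. (X 0 \<omega>)\<^sup>2)" using second_moment by (simp add: X0)
  have "v \<noteq> 0"
  proof
    assume "v = 0"
    then have "AE \<omega> in ?M. (X 0 \<omega>)\<^sup>2 = 0"
      using integral_nonneg_eq_0_iff_AE[OF sq0] by (simp add: v_def)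
    then have "AE \<omega> in ?M. False"
    proof eventually_elim
      case (elim \<omega>)
      then have "ln (a \<omega>) = 0" by (simp add: X0)
      then show ?case using pos[of \<omega>] not_one[of \<omega>] by simp
    qed
    then show False by (simp add: AE_False)
  qed
  moreover have "v \<ge> 0" by (simp add: v_def)
  ultimately have "v > 0" by simp
  have via_distr: "expectation (\<lambda>\<omega>. h (X i \<omega>)) = expectation (\<lambda>\<omega>. h (X 0 \<omega>))"
      "integrable ?M (\<lambda>\<omega>. h (X i \<omega>)) \<longleftrightarrow> integrable ?M (\<lambda>\<omega>. h (X 0 \<omega>))"
    if [measurable]: "h \<in> borel_measurable borel" for h :: "real \<Rightarrow> real" and i
    using integral_distr[of "X i" ?M borel h] integral_distr[of "X 0" ?M borel h]
      integrable_distr_eq[of "X i" ?M borel h] integrable_distr_eq[of "X 0" ?M borel h]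
    by (simp_all add: distr_X)
  interpret centred_iid_walk ?M X "sqrt v"
  proof
    show "indep_vars (\<lambda>_. borel) X UNIV"
      unfolding X_def by (rule indep_vars_compose2[OF bernoulli_coordinates_indep]) simp
    show "distr ?M borel (X n) = distr ?M borel (X 0)" for n by (simp add: distr_X)
    show "expectation (X n) = 0" for n
      using via_distr(1)[of "\<lambda>y. y" n] has_bochner_integral_integral_eq[OF mean_zero] by (simp add: X0)
    show "integrable ?M (\<lambda>\<omega>. (X n \<omega>)\<^sup>2)" for n
      using via_distr(2)[of "\<lambda>y. y\<^sup>2" n] sq0 by simp
    show "expectation (\<lambda>\<omega>. (X n \<omega>)\<^sup>2) = (sqrt v)\<^sup>2" for n
      using via_distr(1)[of "\<lambda>y. y\<^sup>2" n] \<open>v > 0\<close> by (simp add: v_def)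
    show "sqrt v > 0" using \<open>v > 0\<close> by simp
  qed
  let ?u = "\<lambda>\<omega> n. freq (\<lambda>j. S j \<omega> > 0) n"
  define good where "good \<omega> \<longleftrightarrow> (\<forall>K. (\<lambda>n. freq (\<lambda>j. \<bar>S j \<omega>\<bar> \<le> K) n) \<longlonglongrightarrow> 0) \<and>
      (\<forall>c\<in>{0..1}. \<forall>e>0. \<exists>\<^sub>F n in sequentially. \<bar>?u \<omega> n - c\<bar> < e)" for \<omega>
  (* Integer radii suffice by monotonicity in K, and there are only countably many of them. *)
  have "AE \<omega> in ?M. \<forall>K::nat. (\<lambda>n. freq (\<lambda>j. \<bar>S j \<omega>\<bar> \<le> real K) n) \<longlonglongrightarrow> 0"
    unfolding AE_all_countable by (intro allI AE_null_occupation)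
  then have AE_good: "AE \<omega> in ?M. good \<omega>"
    using AE_mostly_positive AE_mostly_negative
  proof eventually_elim
    case (elim \<omega>)
    have "(\<lambda>n. freq (\<lambda>j. \<bar>S j \<omega>\<bar> \<le> K) n) \<longlonglongrightarrow> 0" for K
    proof -
      obtain K' :: nat where K': "K \<le> real K'" using real_arch_simple by blast
      have "freq (\<lambda>j. \<bar>S j \<omega>\<bar> \<le> K) n \<le> freq (\<lambda>j. \<bar>S j \<omega>\<bar> \<le> real K') n" for n
        unfolding freq_def using K' by (intro divide_right_mono sum_mono) auto
      moreover have "0 \<le> freq (\<lambda>j. \<bar>S j \<omega>\<bar> \<le> K) n" for n
        unfolding freq_def by (intro divide_nonneg_nonneg sum_nonneg) auto
      ultimately show ?thesis
        by (intro tendsto_sandwich[OF _ _ tendsto_const elim(1)[rule_format, of K']]) auto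
    qed
    moreover have "\<exists>\<^sub>F n in sequentially. \<bar>?u \<omega> n - c\<bar> < e" if "c \<in> {0..1}" "e > 0" for c e
    proof (rule freq_accumulates_everywhere[OF _ _ that])
      show "\<exists>\<^sub>F n in sequentially. ?u \<omega> n > 1 - \<epsilon>" if "\<epsilon> > 0" for \<epsilon> using elim(2) that by blast
      show "\<exists>\<^sub>F n in sequentially. ?u \<omega> n < \<epsilon>" if "\<epsilon> > 0" for \<epsilon>
      proof -
        have "\<exists>\<^sub>F n in sequentially. freq (\<lambda>j. S j \<omega> < 0) n > 1 - \<epsilon> \<and> n > 0"
          using elim(3) that by (intro frequently_eventually_frequently eventually_gt_at_top) blast
        then show ?thesis
        proof (rule frequently_elim1)
          fix n :: nat assume n: "freq (\<lambda>j. S j \<omega> < 0) n > 1 - \<epsilon> \<and> n > 0"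
          have "freq (\<lambda>j. S j \<omega> < 0) n \<le> freq (\<lambda>j. \<not> S j \<omega> > 0) n + real 0 / real n"
            using n by (intro freq_le_freq_add) auto
          then show "?u \<omega> n < \<epsilon>" using n freq_Not[of n "\<lambda>j. S j \<omega> > 0"] by simp
        qed
      qed
    qed
    ultimately show ?case unfolding good_def by blast
  qed
  define \<psi> where "\<psi> x t = exp t * x / (1 + (exp t - 1) * x)" for x t :: real
  have orbit: "fibre_iter (mobius_fibre a) j \<omega> x = \<psi> x (S j \<omega>)" if "x \<in> {0<..<1}" for j \<omega> x
    using that fibre_iter_mobius[of a x j \<omega>, OF pos] by (simp add: \<psi>_def S_def X_eq)
  have \<psi>: "\<psi> x t \<in> {0..1}" "(\<psi> x \<longlongrightarrow> 1) at_top" "(\<psi> x \<longlongrightarrow> 0) at_bot" if "x \<in> {0<..<1}" for x t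
    using mobius_fibre_unit_interval(2)[of "\<lambda>_. exp t" undefined x] mobius_limits[OF that] that
    unfolding \<psi>_def[abs_def] by (auto simp: mobius_fibre_def)
  have "limit_measures (mobius_fibre a) \<omega> x = dirac_segment ` {0..1}" if "good \<omega>" and x: "x \<in> {0<..<1}" for \<omega> x
  proof (rule limit_measures_eq_segment[where s = "\<lambda>j. S j \<omega>" and \<psi> = "\<psi> x"])
    show "empirical_measure (mobius_fibre a) \<omega> x n \<in> unit_prob_measures" if "n \<ge> 1" for n
      using x that by (intro empirical_measure_in_unit_prob_measures pos) auto
  qed (use that \<psi>[OF x] orbit[OF x] in \<open>auto simp: good_def\<close>)
  moreover have "dirac_segment ` {0..1} = {add_measure (scale_measure (ennreal l) (dirac 0))
      (scale_measure (ennreal (1 - l)) (dirac 1)) | l. l \<in> {0..1}}"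
    by (auto simp: dirac_segment_def)
  ultimately have segment: "\<forall>x\<in>{0<..<1}. AE \<omega> in ?M. limit_measures (mobius_fibre a) \<omega> x =
             {add_measure (scale_measure (ennreal l) (dirac 0))
                (scale_measure (ennreal (1 - l)) (dirac 1)) | l. l \<in> {0..1}}"
    using AE_good by (auto elim: eventually_mono)
  have "historical_behavior_ae (?M \<Otimes>\<^sub>M lebesgue_on {0..1}) (skew_product (mobius_fibre a))"
    unfolding historical_behavior_ae_def
  proof (rule eventually_mono[OF AE_pair_lebesgue_unit[OF prob_space_axioms AE_good]])
    fix z :: "(nat \<Rightarrow> 'a) \<times> real" assume z: "good (fst z) \<and> snd z \<in> {0<..<1}"
    obtain \<omega> x where [simp]: "z = (\<omega>, x)" by fastforce
    have x: "x \<in> {0<..<1}" using z by simp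
    have "\<not> convergent (\<lambda>n. (\<Sum>j<n. \<psi> x (S j \<omega>)) / real n)"
    proof (rule not_convergent_if_accumulates_0_1)
      show "\<exists>\<^sub>F n in sequentially. \<bar>?u \<omega> n - c\<bar> < e" if "c \<in> {0..1}" "e > 0" for c e
        using z that by (simp add: good_def)
      show "(\<lambda>n. (\<Sum>j<n. \<psi> x (S j \<omega>)) / real n - ?u \<omega> n) \<longlonglongrightarrow> 0"
        using average_of_observable[OF \<psi>[OF x], of "\<lambda>j. S j \<omega>" "\<lambda>y. y"] z by (simp add: good_def)
    qed
    then show "\<exists>\<phi>::real \<Rightarrow> real. continuous_on {0..1} \<phi> \<and>
        \<not> convergent (\<lambda>n. (1 / real n) * (\<Sum>j<n. \<phi> (snd ((skew_product (mobius_fibre a) ^^ j) z))))"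
      by (intro exI[of _ "\<lambda>y. y"]) (simp add: skew_product_funpow orbit[OF x])
  qed
  with segment show ?thesis by blast
qed

end
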